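(* The free group of rank 2 has positive density in the set of two-generator subgroups of Thompson's group $T$. That is, for each $n\ge 1$ let $\mathrm{Sph}_2(n)$ be the set of ordered pairs $(D_1,D_2)$ of cyclically marked tree pair diagrams, each of size $n$, and let $U$ be the set of pairs $(D_1,D_2)$ of cyclically marked tree pair diagrams such that the subgroup of $T$ generated by the two elements represented by $D_1$ and $D_2$ is isomorphic to the free group of rank 2. Then the limit $$\lim_{n\to\infty}\frac{|U\cap \mathrm{Sph}_2(n)|}{|\mathrm{Sph}_2(n)|}$$ exists and is positive.
   Context: Trees are finite rooted binary trees in which every internal node has an ordered left child and right child. A tree has size $n$ if it has $n$ internal nodes; it then has $n+1$ leaves, numbered $0,\dots,n$ from left to right. A tree determines a subdivision of $[0,1)$ into half-open dyadic intervals, one per leaf: the root corresponds to $[0,1)$, and if a node corresponds to $[a,b)$ then its left and right children correspond to $[a,\frac{a+b}{2})$ and $[\frac{a+b}{2},b)$. Identify $S^1$ with $[0,1)$, i.e. with $\mathbb{R}/\mathbb{Z}$. Thompson's group $T$ is the group of orientation-preserving piecewise-linear homeomorphisms of $S^1=\mathbb{R}/\mathbb{Z}$ which map dyadic rationals to dyadic rationals, whose slopes, where defined, are powers of $2$, and whose breakpoints lie in the dyadic rationals $\mathbb{Z}[\frac12]$. A cyclically marked tree pair diagram of size $n$ is a triple $(S,R,i)$ where $S$ (source) and $R$ (target) are trees of size $n$ and $i\in\{0,\dots,n\}$ marks the leaf of $R$ to which leaf $0$ of $S$ is sent. The cyclic order determines the rest: leaf $j$ of $S$ is sent to leaf $(i+j)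 \bmod (n+1)$ of $R$. The element of $T$ it represents maps the interval of each leaf of $S$ onto the interval of the corresponding leaf of $R$ by the increasing affine map. There are $(n+1)C_n^2$ such diagrams of size $n$, where $C_n=\frac{1}{n+1}\binom{2n}{n}$. Diagrams are not required to be reduced; all diagrams are counted, so the same element of $T$ may be represented by many diagrams. *)

theory Defs
  imports "HOL-Analysis.Analysis" "HOL-Algebra.Algebra" "HOL-Library.Tree"
begin

section \<open>Trees and dyadic subdivisions\<close>

text \<open>
  A binary tree is a \<^typ>\<open>unit tree\<close>; then \<^const>\<open>size\<close> counts the internal nodes.
  The pair \<^term>\<open>(a, b)\<close> stands for the interval \<^term>\<open>{a..<b}\<close>.
\<close>

fun subdivision :: "unit tree \<Rightarrow> real \<Rightarrow> real \<Rightarrow> (real \<times> real) list" where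
  "subdivision \<langle>\<rangle> a b = [(a, b)]"
| "subdivision \<langle>l, _, r\<rangle> a b = subdivision l a ((a + b) / 2) @ subdivision r ((a + b) / 2) b"

definition leaf_intervals :: "unit tree \<Rightarrow> (real \<times> real) list" where
  "leaf_intervals t = subdivision t 0 1"

definition leaf_at :: "unit tree \<Rightarrow> real \<Rightarrow> nat" where
  "leaf_at t x = (THE j. j \<le> size t \<and> (case leaf_intervals t ! j of (a, b) \<Rightarrow> x \<in> {a..<b}))"


section \<open>Thompson's group T\<close>

definition dyadic_rationals :: "real set" where
  "dyadic_rationals = {of_int m / 2 ^ k | (m :: int) (k :: nat). True}"

text \<open>
  A homeomorphism of \<open>\<real>/\<int>\<close> preserves orientation iff it is induced by a continuous strictly
  increasing \<open>F : \<real> \<rightarrow> \<real>\<close> commuting with \<open>x \<mapsto> x + 1\<close>. Being piecewise linear on the circle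
  means being affine near every point outside a finite set \<open>B\<close> of classes modulo 1,
  here represented in \<^term>\<open>{0..<1}\<close>.
\<close>

definition thompson_lift :: "(real \<Rightarrow> real) \<Rightarrow> bool" where
  "thompson_lift F \<longleftrightarrow>
     continuous_on UNIV F \<and> strict_mono F \<and> (\<forall>x. F (x + 1) = F x + 1) \<and>
     F ` dyadic_rationals \<subseteq> dyadic_rationals \<and>
     (\<exists>B. finite B \<and> B \<subseteq> dyadic_rationals \<inter> {0..<1} \<and>
        (\<forall>x. frac x \<notin> B \<longrightarrow>
           (\<exists>(k :: int) c. \<forall>\<^sub>F y in nhds x. F y = 2 powi k * y + c)))"

definition thompson_T :: "(real \<Rightarrow> real) monoid" where
  "thompson_T = BijGroup {0..<1}
     \<lparr>carrier := {f \<in> Bij {0..<1}. \<exists>F. thompson_lift F \<and> (\<forall>x\<in>{0..<1}. f x = frac (F x))}\<rparr>"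


section \<open>Cyclically marked tree pair diagrams\<close>

type_synonym tree_pair = "unit tree \<times> unit tree \<times> nat"

definition diagrams_of_size :: "nat \<Rightarrow> tree_pair set" where
  "diagrams_of_size n = {(S, R, i). size S = n \<and> size R = n \<and> i \<le> n}"

definition diagrams :: "tree_pair set" where
  "diagrams = (\<Union>n. diagrams_of_size n)"

fun represented :: "tree_pair \<Rightarrow> real \<Rightarrow> real" where
  "represented (S, R, i) =
     (\<lambda>x\<in>{0..<1}.
        let j = leaf_at S x;
            (a, b) = leaf_intervals S ! j;
            (c, d) = leaf_intervals R ! ((i + j) mod (size S + 1))
        in c + (d - c) * ((x - a) / (b - a)))"

definition Sph2 :: "nat \<Rightarrow> (tree_pair \<times> tree_pair) set" where
  "Sph2 n = diagrams_of_size n \<times> diagrams_of_size n"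


section \<open>Free groups\<close>

text \<open>
  Letters are pairs \<^term>\<open>(x, e)\<close>, where \<^term>\<open>e\<close> tells whether the letter is \<^term>\<open>x\<close> or
  its formal inverse. The elements of the free group are the reduced words, and
  \<open>free_cons\<close> multiplies a reduced word by a letter from the left.
\<close>

definition inv_letter :: "'a \<times> bool \<Rightarrow> 'a \<times> bool" where
  "inv_letter p = (fst p, \<not> snd p)"

definition reduced_word :: "('a \<times> bool) list \<Rightarrow> bool" where
  "reduced_word w \<longleftrightarrow> successively (\<lambda>p q. q \<noteq> inv_letter p) w"

fun free_cons :: "'a \<times> bool \<Rightarrow> ('a \<times> bool) list \<Rightarrow> ('a \<times> bool) list" where
  "free_cons p [] = [p]"
| "free_cons p (q # w) = (if q = inv_letter p then w else p # q # w)"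

definition free_group :: "'a set \<Rightarrow> ('a \<times> bool) list monoid" where
  "free_group A =
     \<lparr>carrier = {w \<in> lists (A \<times> UNIV). reduced_word w},
      mult = (\<lambda>v w. foldr free_cons v w),
      one = []\<rparr>"

definition free_pairs :: "(tree_pair \<times> tree_pair) set" where
  "free_pairs = {(D1, D2). D1 \<in> diagrams \<and> D2 \<in> diagrams \<and>
     subgroup_generated thompson_T {represented D1, represented D2} \<cong> free_group {..<2 :: nat}}"

end

theory Submission
  imports Defs "HOL-Computational_Algebra.Formal_Power_Series" "HOL-Real_Asymp.Real_Asymp"
begin

text \<open>
  The limit is 1. A uniformly random tree of large size \<open>n\<close> has, at each fixed depth \<open>d\<close>, one
  subtree containing all but a bounded number of the leaves, and its address is asymptotically
  uniform among the \<open>2\<^sup>d\<close> addresses. Let \<open>w\<close> and \<open>v\<close> be these addresses for the source and the target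
  of a random diagram. As the mark is uniform among \<open>n + 1\<close> values, with high probability every
  leaf outside the giant subtree of the source goes to a leaf inside that of the target, so the
  element maps the complement of the dyadic interval of \<open>w\<close> into that of \<open>v\<close>. For large \<open>d\<close> the four
  addresses belonging to a random pair are distinct with probability close to 1, and then the two
  elements play ping-pong.
\<close>

section \<open>The ping-pong lemma\<close>

text \<open>Uniformity of the giant address rests on the identity sum over k of C_k / 4^(k+1) = 1/2
  for the Catalan numbers C_k. As C_(n-m) / C_n tends to 4^(-m), the k-th term is the limiting
  probability that a fixed child of the root has size k. So each child is the bounded one with
  probability 1/2, which leaves no mass for two unbounded children, and iterating along an address
  of length d gives 2^(-d). Only lower bounds on counts are proved: the ratio never exceeds 1, so it
  is enough to exhibit sufficiently many ping-pong pairs. These bounds may be added because a tree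
  has at most one giant address of each length once 2K < n. Inverses need no separate estimate: if a
  bijection maps the complement of one cell into a second cell, its inverse does the same with the
  two cells exchanged. The order of choices is d, then K, then n.\<close>

lemma inv_letter_in_iff [simp]: "inv_letter p \<in> A \<times> UNIV \<longleftrightarrow> p \<in> A \<times> UNIV"
  by (cases p) (auto simp: inv_letter_def)

lemma reduced_word_Cons:
  "reduced_word (p # w) \<longleftrightarrow> reduced_word w \<and> (w = [] \<or> hd w \<noteq> inv_letter p)"
  by (cases w) (auto simp: reduced_word_def)

lemma reduced_free_cons: "reduced_word w \<Longrightarrow> reduced_word (free_cons p w)"
  by (cases w) (auto simp: reduced_word_Cons)

lemma set_free_cons: "set (free_cons p w) \<subseteq> insert p (set w)"
  by (cases w) auto

lemma free_group_mult_closed: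
  assumes "v \<in> carrier (free_group A)" "w \<in> carrier (free_group A)"
  shows "foldr free_cons v w \<in> carrier (free_group A)"
proof -
  have "set (foldr free_cons v w) \<subseteq> set v \<union> set w" for v w :: "('a \<times> bool) list"
  proof (induction v)
    case (Cons p v)
    then show ?case using set_free_cons[of p "foldr free_cons v w"] by auto
  qed simp
  moreover have "reduced_word w \<Longrightarrow> reduced_word (foldr free_cons v w)" for v w :: "('a \<times> bool) list"
    by (induction v) (auto intro: reduced_free_cons)
  ultimately show ?thesis
    using assms by (simp add: free_group_def lists_eq_set) (meson Un_least order_trans)
qed

text \<open>\<open>U p\<close> is the attracting set of the letter \<open>p\<close> and
  \<open>U (inv_letter p)\<close> its repelling set. The base point outside all these sets tells the
  empty word from the others, since a nonempty reduced word moves it into some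
  \<open>U p\<close>.\<close>

locale ping_pong =
  fixes S :: "'a set" and I :: "'i set" and L :: "'i \<times> bool \<Rightarrow> 'a \<Rightarrow> 'a"
    and U :: "'i \<times> bool \<Rightarrow> 'a set" and x0 :: 'a
  assumes letter_Bij: "p \<in> I \<times> UNIV \<Longrightarrow> L p \<in> Bij S"
    and letter_inv: "p \<in> I \<times> UNIV \<Longrightarrow> L (inv_letter p) = inv\<^bsub>BijGroup S\<^esub> L p"
    and pong: "p \<in> I \<times> UNIV \<Longrightarrow> x \<in> S \<Longrightarrow> x \<notin> U (inv_letter p) \<Longrightarrow> L p x \<in> U p"
    and disjoint: "p \<in> I \<times> UNIV \<Longrightarrow> q \<in> I \<times> UNIV \<Longrightarrow> p \<noteq> q \<Longrightarrow> U p \<inter> U q = {}"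
    and base_in: "x0 \<in> S" and base_notin: "p \<in> I \<times> UNIV \<Longrightarrow> x0 \<notin> U p"
begin

abbreviation (input) G where "G \<equiv> BijGroup S"

lemma carrier_G: "carrier G = Bij S"
  by (simp add: BijGroup_def)

sublocale G: group G
  by (rule group_BijGroup)

definition eval_word :: "('i \<times> bool) list \<Rightarrow> 'a \<Rightarrow> 'a" where
  "eval_word w = foldr (\<lambda>p g. L p \<otimes>\<^bsub>G\<^esub> g) w \<one>\<^bsub>G\<^esub>"

lemma eval_Nil [simp]: "eval_word [] = \<one>\<^bsub>G\<^esub>"
  and eval_Cons [simp]: "eval_word (p # w) = L p \<otimes>\<^bsub>G\<^esub> eval_word w"
  by (simp_all add: eval_word_def)

lemma letter_closed: "p \<in> I \<times> UNIV \<Longrightarrow> L p \<in> carrier G"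
  using letter_Bij carrier_G by simp

lemma eval_closed: "set w \<subseteq> I \<times> UNIV \<Longrightarrow> eval_word w \<in> carrier G"
  by (induction w) (auto intro!: G.m_closed letter_closed)

lemma mult_apply: "g \<in> carrier G \<Longrightarrow> h \<in> carrier G \<Longrightarrow> x \<in> S \<Longrightarrow> (g \<otimes>\<^bsub>G\<^esub> h) x = g (h x)"
  by (simp add: BijGroup_def compose_def)

lemma eval_free_cons:
  assumes "p \<in> I \<times> UNIV" "set w \<subseteq> I \<times> UNIV"
  shows "eval_word (free_cons p w) = L p \<otimes>\<^bsub>G\<^esub> eval_word w"
proof (cases "\<exists>w'. w = inv_letter p # w'")
  case True
  then obtain w' where w: "w = inv_letter p # w'" by blast
  with assms have "eval_word w' \<in> carrier G" by (intro eval_closed) auto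
  then have "L p \<otimes>\<^bsub>G\<^esub> (inv\<^bsub>G\<^esub> L p \<otimes>\<^bsub>G\<^esub> eval_word w') = eval_word w'"
    using letter_closed[OF assms(1)] by (simp flip: G.m_assoc)
  then show ?thesis
    using w letter_inv[OF assms(1)] by simp
next
  case False
  then have "free_cons p w = p # w" by (cases w) auto
  then show ?thesis by simp
qed

lemma eval_mult:
  assumes "set v \<subseteq> I \<times> UNIV" "set w \<subseteq> I \<times> UNIV"
  shows "eval_word (foldr free_cons v w) = eval_word v \<otimes>\<^bsub>G\<^esub> eval_word w"
proof -
  \<comment> \<open>The bound on the letters goes through the same induction because
    \<open>eval_free_cons\<close> needs it for the product of the tail.\<close>
  have "set (foldr free_cons v w) \<subseteq> I \<times> UNIV \<and> ?thesis"
    using assms(1)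
  proof (induction v)
    case Nil
    then show ?case using assms(2) by (auto simp: eval_closed)
  next
    case (Cons p v)
    then have IH: "set (foldr free_cons v w) \<subseteq> I \<times> UNIV"
      "eval_word (foldr free_cons v w) = eval_word v \<otimes>\<^bsub>G\<^esub> eval_word w" and p: "p \<in> I \<times> UNIV"
      by auto
    then show ?case
      using Cons.prems assms(2) set_free_cons[of p "foldr free_cons v w"]
      by (simp add: eval_free_cons letter_closed eval_closed G.m_assoc) (meson insert_subset order_trans)
  qed
  then show ?thesis by blast
qed

lemma eval_in_space:
  assumes "set w \<subseteq> I \<times> UNIV"
  shows "eval_word w x0 \<in> S"
  using Bij_imp_funcset[of "eval_word w" S] eval_closed[OF assms] base_in by (auto simp: carrier_G)

text \<open>The tail either fixes the base point, being empty, or moves it into the set of its own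
  first letter. Reducedness makes that letter different from \<open>inv_letter p\<close>, so by
  disjointness the point avoids \<open>U (inv_letter p)\<close> and \<open>pong\<close>
  applies.\<close>

lemma eval_base:
  assumes "set w \<subseteq> I \<times> UNIV" "reduced_word w" "w \<noteq> []"
  shows "eval_word w x0 \<in> U (hd w)"
  using assms
proof (induction w)
  case (Cons p w)
  have p: "p \<in> I \<times> UNIV" "inv_letter p \<in> I \<times> UNIV" and w: "set w \<subseteq> I \<times> UNIV"
    using Cons.prems by auto
  have "eval_word w x0 \<notin> U (inv_letter p)"
  proof (cases "w = []")
    case True
    then show ?thesis using base_notin[OF p(2)] base_in by (simp add: BijGroup_def)
  next
    case False
    then have "eval_word w x0 \<in> U (hd w)" "hd w \<noteq> inv_letter p" "hd w \<in> I \<times> UNIV"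
      using Cons w hd_in_set[OF False] by (auto simp: reduced_word_Cons)
    then show ?thesis using disjoint[of "hd w" "inv_letter p"] p(2) by (metis IntI emptyE)
  qed
  then have "L p (eval_word w x0) \<in> U p"
    using pong[OF p(1)] eval_in_space[OF w] by blast
  then show ?case
    using mult_apply[OF letter_closed[OF p(1)] eval_closed[OF w] base_in] by simp
qed simp

lemma eval_eq_one:
  assumes "set w \<subseteq> I \<times> UNIV" "reduced_word w" "eval_word w = \<one>\<^bsub>G\<^esub>"
  shows "w = []"
proof (rule ccontr)
  assume "w \<noteq> []"
  then have "hd w \<in> I \<times> UNIV" using assms(1) hd_in_set by blast
  moreover have "eval_word w x0 = x0" using assms(3) base_in by (simp add: BijGroup_def)
  ultimately show False
    using eval_base[OF assms(1,2) \<open>w \<noteq> []\<close>] base_notin[of "hd w"] by simp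
qed

text \<open>The image of the base point reveals the first letter of a reduced word. Peeling off
  equal first letters and cancelling in \<open>BijGroup S\<close> reaches the claim without forming
  inverses of reduced words.\<close>

lemma inj_eval: "inj_on eval_word (carrier (free_group I))"
proof -
  have "v = w" if "set v \<subseteq> I \<times> UNIV" "reduced_word v" "set w \<subseteq> I \<times> UNIV" "reduced_word w"
    "eval_word v = eval_word w" for v w
    using that
  proof (induction v arbitrary: w)
    case Nil
    then show ?case using eval_eq_one[of w] by simp
  next
    case (Cons p v)
    have "w \<noteq> []" using Cons.prems eval_eq_one[of "p # v"] by auto
    then obtain q w' where w: "w = q # w'" by (cases w) auto
    have "p = q"
    proof (rule ccontr)
      assume "p \<noteq> q"
      then have "U p \<inter> U q = {}" using Cons.prems w by (intro disjoint) auto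
      moreover have "eval_word (p # v) x0 \<in> U p" "eval_word w x0 \<in> U q"
        using eval_base[of "p # v"] eval_base[of w] Cons.prems w by auto
      ultimately show False using Cons.prems(5) by auto
    qed
    moreover have "eval_word v = eval_word w'"
      using Cons.prems w \<open>p = q\<close> letter_closed[of p] eval_closed[of v] eval_closed[of w'] by simp
    ultimately show ?case
      using Cons.prems w Cons.IH[of w'] by (auto simp: reduced_word_Cons)
  qed
  then show ?thesis
    by (intro inj_onI) (simp add: free_group_def lists_eq_set)
qed

text \<open>
  The carrier is cut down to an arbitrary set \<open>H\<close> that need not be a subgroup: the subgroup
  generated by some elements only depends on these elements and on their inverses lying in \<open>H\<close>.
\<close>

lemma free:
  assumes H: "H \<subseteq> Bij S" "\<And>p. p \<in> I \<times> UNIV \<Longrightarrow> L p \<in> H"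
  shows "subgroup_generated (G\<lparr>carrier := H\<rparr>) ((\<lambda>i. L (i, True)) ` I) \<cong> free_group I"
proof -
  let ?T = "G\<lparr>carrier := H\<rparr>" and ?X = "(\<lambda>i. L (i, True)) ` I" and ?F = "free_group I"
  have F: "carrier ?F = {w. set w \<subseteq> I \<times> UNIV \<and> reduced_word w}"
    by (auto simp: free_group_def lists_eq_set)
  \<comment> \<open>\<open>subgroup_generated\<close> intersects the generators with the
    carrier.\<close>
  have X: "H \<inter> ?X = ?X" using H by auto
  \<comment> \<open>\<open>m_inv\<close> is a description over the carrier, so its value in
    \<open>?T\<close> has to be determined anew; uniqueness is inherited from the larger
    group.\<close>
  have inv_T: "inv\<^bsub>?T\<^esub> L (i, True) = L (i, False)" if "i \<in> I" for i
  proof -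
    have L: "L (i, True) \<in> carrier G" "L (i, False) \<in> carrier G" "L (i, False) \<in> H"
      using letter_closed H that by auto
    have inv: "L (i, False) = inv\<^bsub>G\<^esub> L (i, True)"
      using letter_inv[of "(i, True)"] that by (simp add: inv_letter_def)
    show ?thesis
      unfolding m_inv_def
    proof (rule the_equality)
      show "L (i, False) \<in> carrier ?T \<and> L (i, True) \<otimes>\<^bsub>?T\<^esub> L (i, False) = \<one>\<^bsub>?T\<^esub> \<and>
          L (i, False) \<otimes>\<^bsub>?T\<^esub> L (i, True) = \<one>\<^bsub>?T\<^esub>"
        using L inv by simp
    next
      fix y
      assume "y \<in> carrier ?T \<and> L (i, True) \<otimes>\<^bsub>?T\<^esub> y = \<one>\<^bsub>?T\<^esub> \<and> y \<otimes>\<^bsub>?T\<^esub> L (i, True) = \<one>\<^bsub>?T\<^esub>"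
      then have "y \<in> carrier G" "y \<otimes>\<^bsub>G\<^esub> L (i, True) = \<one>\<^bsub>G\<^esub>"
        using H carrier_G by auto
      then show "y = L (i, False)"
        using L inv G.inv_equality by metis
    qed
  qed
  have gen: "generate ?T ?X = eval_word ` carrier ?F"
  proof (intro equalityI subsetI)
    fix g
    assume "g \<in> generate ?T ?X"
    then show "g \<in> eval_word ` carrier ?F"
    proof (induction rule: generate.induct)
      case one
      have "[] \<in> carrier ?F" by (simp add: F reduced_word_def)
      then show ?case by (force intro: image_eqI[of _ _ "[]"])
    next
      case (incl h)
      then obtain i where i: "i \<in> I" "h = L (i, True)" by blast
      then have "h = eval_word [(i, True)]" using letter_closed[of "(i, True)"] by simp
      moreover have "[(i, True)] \<in> carrier ?F" using i by (simp add: F reduced_word_def)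
      ultimately show ?case by blast
    next
      case (inv h)
      then obtain i where i: "i \<in> I" "h = L (i, True)" by blast
      then have "inv\<^bsub>?T\<^esub> h = eval_word [(i, False)]"
        using letter_closed[of "(i, False)"] inv_T by simp
      moreover have "[(i, False)] \<in> carrier ?F" using i by (simp add: F reduced_word_def)
      ultimately show ?case by blast
    next
      case (eng g h)
      then obtain v w where vw: "v \<in> carrier ?F" "w \<in> carrier ?F" "g = eval_word v" "h = eval_word w"
        by blast
      then have "g \<otimes>\<^bsub>?T\<^esub> h = eval_word (foldr free_cons v w)"
        using eval_mult F by simp
      then show ?case using free_group_mult_closed vw by blast
    qed
  next
    fix g
    assume "g \<in> eval_word ` carrier ?F"
    then obtain w where w: "set w \<subseteq> I \<times> UNIV" and g: "g = eval_word w" by (auto simp: F)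
    have "eval_word w \<in> generate ?T ?X"
      using w
    proof (induction w)
      case Nil
      then show ?case using generate.one[of ?T ?X] by simp
    next
      case (Cons p w)
      obtain i e where p: "p = (i, e)" by (cases p)
      have i: "i \<in> I" using Cons.prems p by simp
      have "L p \<in> generate ?T ?X"
        using generate.incl[of "L (i, True)" ?X ?T] generate.inv[of "L (i, True)" ?X ?T] inv_T[OF i] i p
        by (cases e) auto
      then show ?case
        using generate.eng[of "L p" ?T ?X "eval_word w"] Cons by simp
    qed
    then show "g \<in> generate ?T ?X" using g by simp
  qed
  \<comment> \<open>The isomorphism has to start at the generated subgroup, so the injective map
    \<open>eval_word\<close> is inverted on its range.\<close>
  let ?h = "inv_into (carrier ?F) eval_word"
  have "?h \<in> iso (subgroup_generated ?T ?X) ?F"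
  proof (rule isoI)
    show "?h \<in> hom (subgroup_generated ?T ?X) ?F"
    proof (rule homI)
      fix x
      assume "x \<in> carrier (subgroup_generated ?T ?X)"
      then show "?h x \<in> carrier ?F"
        using gen X by (simp add: subgroup_generated_def inv_into_into)
    next
      fix x y
      assume "x \<in> carrier (subgroup_generated ?T ?X)" "y \<in> carrier (subgroup_generated ?T ?X)"
      then obtain v w where vw: "v \<in> carrier ?F" "w \<in> carrier ?F" "x = eval_word v" "y = eval_word w"
        using gen X by (auto simp: subgroup_generated_def)
      then have "x \<otimes>\<^bsub>subgroup_generated ?T ?X\<^esub> y = eval_word (foldr free_cons v w)"
        using eval_mult F by (simp add: subgroup_generated_def)
      then show "?h (x \<otimes>\<^bsub>subgroup_generated ?T ?X\<^esub> y) = ?h x \<otimes>\<^bsub>?F\<^esub> ?h y"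
        using vw free_group_mult_closed[OF vw(1,2)] inj_eval by (simp add: inv_into_f_f free_group_def)
    qed
    show "bij_betw ?h (carrier (subgroup_generated ?T ?X)) (carrier ?F)"
      using gen X inj_eval
      by (simp add: subgroup_generated_def bij_betw_inv_into inj_on_imp_bij_betw)
  qed
  then show ?thesis by (rule is_isoI)
qed

end

section \<open>Piecewise linear maps between dyadic partitions\<close>

lemma dyadic_rationalsI: "x = of_int m / 2 ^ k \<Longrightarrow> x \<in> dyadic_rationals"
  by (auto simp: dyadic_rationals_def)

lemma dyadic_of_int [simp]: "of_int m \<in> dyadic_rationals"
  by (rule dyadic_rationalsI[of _ m 0]) simp

lemma dyadic_0 [simp]: "0 \<in> dyadic_rationals" and dyadic_1 [simp]: "1 \<in> dyadic_rationals"
  using dyadic_of_int[of 0] dyadic_of_int[of 1] by simp_all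

lemma dyadic_add [simp]:
  assumes "x \<in> dyadic_rationals" "y \<in> dyadic_rationals"
  shows "x + y \<in> dyadic_rationals"
proof -
  obtain m k n l where "x = of_int m / 2 ^ k" "y = of_int n / 2 ^ l"
    using assms by (auto simp: dyadic_rationals_def)
  then have "x + y = of_int (m * 2 ^ l + n * 2 ^ k) / 2 ^ (k + l)"
    by (simp add: power_add add_frac_eq)
  then show ?thesis by (rule dyadic_rationalsI)
qed

lemma dyadic_mult [simp]:
  assumes "x \<in> dyadic_rationals" "y \<in> dyadic_rationals"
  shows "x * y \<in> dyadic_rationals"
proof -
  obtain m k n l where "x = of_int m / 2 ^ k" "y = of_int n / 2 ^ l"
    using assms by (auto simp: dyadic_rationals_def)
  then have "x * y = of_int (m * n) / 2 ^ (k + l)"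
    by (simp add: power_add)
  then show ?thesis by (rule dyadic_rationalsI)
qed

lemma dyadic_diff [simp]:
  assumes "x \<in> dyadic_rationals" "y \<in> dyadic_rationals"
  shows "x - y \<in> dyadic_rationals"
  using dyadic_add[OF assms(1) dyadic_mult[OF dyadic_of_int[of "-1"] assms(2)]] by simp

lemma dyadic_half [simp]: "x \<in> dyadic_rationals \<Longrightarrow> x / 2 \<in> dyadic_rationals"
  using dyadic_mult[of x "1 / 2"] dyadic_rationalsI[of "1/2" 1 1] by simp

lemma dyadic_powi [simp]: "2 powi k \<in> dyadic_rationals"
proof (cases "k \<ge> 0")
  case True
  then show ?thesis
    by (intro dyadic_rationalsI[of _ "2 ^ nat k" 0]) (simp add: power_int_def)
next
  case False
  then show ?thesis
    by (intro dyadic_rationalsI[of _ 1 "nat (- k)"]) (simp add: power_int_def field_simps)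
qed

text \<open>A subdivision of the circle is lifted to the line and its endpoints are indexed by all
  integers. The mark of a diagram then becomes a plain shift of the index, and wrapping around the
  circle becomes a translation by an integer.\<close>

definition dyadic_partition :: "nat \<Rightarrow> (int \<Rightarrow> real) \<Rightarrow> bool" where
  "dyadic_partition N A \<longleftrightarrow> N > 0 \<and> (\<forall>j. A (j + int N) = A j + 1) \<and>
     (\<forall>j. A j \<in> dyadic_rationals) \<and> (\<forall>j. \<exists>k :: int. A (j + 1) - A j = 2 powi k)"

definition piece :: "(int \<Rightarrow> real) \<Rightarrow> real \<Rightarrow> int" where
  "piece A x = (THE j. A j \<le> x \<and> x < A (j + 1))"

definition pl_map :: "(int \<Rightarrow> real) \<Rightarrow> (int \<Rightarrow> real) \<Rightarrow> real \<Rightarrow> real" where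
  "pl_map A C x = (let j = piece A x in
     C j + (C (j + 1) - C j) * ((x - A j) / (A (j + 1) - A j)))"

lemma dyadic_partition_shift:
  "dyadic_partition N A \<Longrightarrow> dyadic_partition N (\<lambda>j. A (j + i))"
  unfolding dyadic_partition_def by (metis add.assoc add.commute)

context
  fixes N :: nat and A :: "int \<Rightarrow> real"
  assumes A: "dyadic_partition N A"
begin

lemma partition_less_step: "A j < A (j + 1)"
proof -
  obtain k :: int where "A (j + 1) - A j = 2 powi k"
    using A unfolding dyadic_partition_def by blast
  moreover have "(2 :: real) powi k > 0" by simp
  ultimately show ?thesis by linarith
qed

lemma partition_strict_mono: "strict_mono A"
proof (rule strict_monoI)
  fix i j :: int
  assume "i < j"
  then show "A i < A j"
    by (induction rule: int_gr_induct) (use partition_less_step less_trans in blast)+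
qed

lemma partition_le_iff [simp]: "A i \<le> A j \<longleftrightarrow> i \<le> j"
  using partition_strict_mono by (rule strict_mono_less_eq)

lemma partition_less_iff [simp]: "A i < A j \<longleftrightarrow> i < j"
  using partition_strict_mono by (rule strict_mono_less)

lemma partition_add_period: "A (j + k * int N) = A j + of_int k"
proof -
  have step: "A (j + int N) = A j + 1" for j using A by (simp add: dyadic_partition_def)
  show ?thesis
  proof (induction k rule: int_induct[of _ 0])
    case (step1 i)
    then show ?case using step[of "j + i * int N"] by (simp add: algebra_simps)
  next
    case (step2 i)
    then show ?case using step[of "j + (i - 1) * int N"] by (simp add: algebra_simps)
  qed simp
qed

lemma piece_unique:
  assumes "A i \<le> x" "x < A (i + 1)" "A j \<le> x" "x < A (j + 1)"
  shows "i = j"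
proof -
  have "A i < A (j + 1)" "A j < A (i + 1)" using assms by linarith+
  then show ?thesis by simp
qed

lemma piece_eq: "A j \<le> x \<Longrightarrow> x < A (j + 1) \<Longrightarrow> piece A x = j"
  unfolding piece_def by (rule the_equality) (use piece_unique in blast)+

lemma piece_bounds: "A (piece A x) \<le> x" "x < A (piece A x + 1)"
proof -
  have N: "N > 0" using A by (simp add: dyadic_partition_def)
  \<comment> \<open>The floor finds the period that contains \<open>x\<close>; within it the piece
    is the last of finitely many endpoints not exceeding \<open>x\<close>.\<close>
  define k where "k = \<lfloor>x - A 0\<rfloor>"
  define J where "J = {j. k * int N \<le> j \<and> j \<le> (k + 1) * int N \<and> A j \<le> x}"
  have lo: "A (k * int N) \<le> x" and hi: "x < A ((k + 1) * int N)"
    using partition_add_period[of 0 k] partition_add_period[of 0 "k + 1"] unfolding k_def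
    by (simp_all; linarith)+
  have J: "finite J" "J \<noteq> {}"
  proof -
    have "J \<subseteq> {k * int N..(k + 1) * int N}" by (auto simp: J_def)
    then show "finite J" by (rule finite_subset) simp
    have "k * int N \<in> J" using lo by (simp add: J_def algebra_simps)
    then show "J \<noteq> {}" by blast
  qed
  define j where "j = Max J"
  have j: "j \<in> J" using J by (simp add: j_def)
  have "j \<noteq> (k + 1) * int N" using j hi by (auto simp: J_def)
  then have "j + 1 \<le> (k + 1) * int N" "k * int N \<le> j + 1" using j by (auto simp: J_def)
  moreover have "j + 1 \<notin> J" using Max_ge[OF J(1), of "j + 1"] by (auto simp flip: j_def)
  ultimately have "x < A (j + 1)" by (simp add: J_def)
  moreover have "A j \<le> x" using j by (simp add: J_def)
  ultimately have "piece A x = j" by (rule piece_eq[rotated])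
  with \<open>x < A (j + 1)\<close> \<open>A j \<le> x\<close> show "A (piece A x) \<le> x" "x < A (piece A x + 1)" by auto
qed

lemma piece_le_iff: "A j \<le> x \<longleftrightarrow> j \<le> piece A x"
proof
  assume "A j \<le> x"
  then have "A j < A (piece A x + 1)" using piece_bounds(2)[of x] by linarith
  then show "j \<le> piece A x" by simp
next
  assume "j \<le> piece A x"
  then have "A j \<le> A (piece A x)" by simp
  then show "A j \<le> x" using piece_bounds(1)[of x] by linarith
qed

lemma piece_mono: "x \<le> y \<Longrightarrow> piece A x \<le> piece A y"
  using piece_bounds(1)[of x] piece_le_iff[of "piece A x" y] by linarith

lemma piece_add_1: "piece A (x + 1) = piece A x + int N"
proof (rule piece_eq)
  have "A (piece A x + int N) = A (piece A x) + 1" "A (piece A x + int N + 1) = A (piece A x + 1) + 1"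
    using partition_add_period[of "piece A x" 1] partition_add_period[of "piece A x + 1" 1]
    by (simp_all add: algebra_simps)
  then show "A (piece A x + int N) \<le> x + 1" "x + 1 < A (piece A x + int N + 1)"
    using piece_bounds[of x] by simp_all
qed

end

context
  fixes N :: nat and A C :: "int \<Rightarrow> real"
  assumes A: "dyadic_partition N A" and C: "dyadic_partition N C"
begin

lemma pl_map_bounds:
  "C (piece A x) \<le> pl_map A C x" "pl_map A C x < C (piece A x + 1)"
proof -
  define j where "j = piece A x"
  define t where "t = (x - A j) / (A (j + 1) - A j)"
  have "0 \<le> t" "t < 1"
    using piece_bounds[OF A, of x] by (simp_all add: t_def j_def)
  moreover have "pl_map A C x = C j + (C (j + 1) - C j) * t"
    by (simp add: pl_map_def Let_def j_def t_def)
  moreover have "C j < C (j + 1)" using partition_less_step[OF C] .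
  moreover from this \<open>t < 1\<close> have "(C (j + 1) - C j) * t < (C (j + 1) - C j) * 1"
    by (intro mult_strict_left_mono) auto
  then have "(C (j + 1) - C j) * t < C (j + 1) - C j" by simp
  moreover have "0 \<le> (C (j + 1) - C j) * t"
    using \<open>0 \<le> t\<close> \<open>C j < C (j + 1)\<close> by simp
  ultimately show "C (piece A x) \<le> pl_map A C x" "pl_map A C x < C (piece A x + 1)"
    unfolding j_def[symmetric] by linarith+
qed

lemma piece_pl_map: "piece C (pl_map A C x) = piece A x"
  using pl_map_bounds by (intro piece_eq[OF C])

lemma pl_map_inverse: "pl_map C A (pl_map A C x) = x"
proof -
  have "A (piece A x) < A (piece A x + 1)" "C (piece A x) < C (piece A x + 1)"
    using partition_less_step[OF A] partition_less_step[OF C] by auto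
  then show ?thesis
    using piece_pl_map[of x] by (simp add: pl_map_def[of C A] Let_def) (simp add: pl_map_def Let_def)
qed

lemma pl_map_add_1: "pl_map A C (x + 1) = pl_map A C x + 1"
proof -
  have step: "A (j + int N) = A j + 1" "C (j + int N) = C j + 1" for j
    using A C by (auto simp: dyadic_partition_def)
  have "A (j + int N + 1) = A (j + 1) + 1" "C (j + int N + 1) = C (j + 1) + 1" for j
    using step[of "j + 1"] by (simp_all add: algebra_simps)
  then show ?thesis by (simp add: pl_map_def Let_def piece_add_1[OF A] step)
qed

lemma pl_map_strict_mono: "strict_mono (pl_map A C)"
proof (rule strict_monoI)
  fix x y :: real
  assume "x < y"
  show "pl_map A C x < pl_map A C y"
  proof (cases "piece A x = piece A y")
    case True
    then show ?thesis
      using \<open>x < y\<close> partition_less_step[OF A, of "piece A y"] partition_less_step[OF C, of "piece A y"]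
      by (simp add: pl_map_def Let_def divide_strict_right_mono mult_strict_left_mono)
  next
    case False
    then have "piece A x + 1 \<le> piece A y"
      using piece_mono[OF A, of x y] \<open>x < y\<close> by simp
    then have "C (piece A x + 1) \<le> C (piece A y)" using partition_le_iff[OF C] by blast
    then show ?thesis using pl_map_bounds[of x] pl_map_bounds[of y] by linarith
  qed
qed

text \<open>Slope and intercept are chosen before \<open>x\<close>, which is what being affine near
  a point requires. The dyadic intercept yields the preservation of dyadic rationals.\<close>

lemma pl_map_affine:
  "\<exists>(k :: int) c. c \<in> dyadic_rationals \<and> (\<forall>x. piece A x = j \<longrightarrow> pl_map A C x = 2 powi k * x + c)"
proof -
  obtain k l :: int where kl: "A (j + 1) - A j = 2 powi k" "C (j + 1) - C j = 2 powi l"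
    using A C unfolding dyadic_partition_def by metis
  have Aj: "A j \<in> dyadic_rationals" "C j \<in> dyadic_rationals"
    using A C unfolding dyadic_partition_def by auto
  have "pl_map A C x = 2 powi (l - k) * x + (C j - 2 powi (l - k) * A j)" if "piece A x = j" for x
  proof -
    have "pl_map A C x = C j + 2 powi l * ((x - A j) / 2 powi k)"
      using that kl by (simp add: pl_map_def Let_def)
    then show ?thesis by (simp add: power_int_diff diff_divide_distrib right_diff_distrib)
  qed
  moreover have "C j - 2 powi (l - k) * A j \<in> dyadic_rationals"
    using Aj by simp
  ultimately show ?thesis by blast
qed

end

lemma pl_map_surj:
  assumes "dyadic_partition N A" "dyadic_partition N C"
  shows "surj (pl_map A C)"
  using pl_map_inverse[OF assms(2,1)] by (rule surjI)

lemma thompson_lift_pl_map: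
  assumes A: "dyadic_partition N A" and C: "dyadic_partition N C"
  shows "thompson_lift (pl_map A C)"
  unfolding thompson_lift_def
\<comment> \<open>Modulo 1 the endpoints of a single period are all the breakpoints.\<close>
proof (intro conjI allI exI[of _ "(\<lambda>j. frac (A j)) ` {0..<int N}"] impI)
  have mono: "strict_mono (pl_map A C)" by (rule pl_map_strict_mono[OF A C])
  then show "strict_mono (pl_map A C)" .
  show "continuous_on UNIV (pl_map A C)"
  \<comment> \<open>A monotone map with open range has no jumps, and here the range is the whole
    line.\<close>
  proof (rule continuous_onI_mono)
    show "open (pl_map A C ` UNIV)" using pl_map_surj[OF A C] by simp
    show "pl_map A C x \<le> pl_map A C y" if "x \<le> y" for x y
      using that strict_mono_less_eq[OF mono] by blast
  qed
  show "pl_map A C (x + 1) = pl_map A C x + 1" for x by (rule pl_map_add_1[OF A C])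
  show "pl_map A C ` dyadic_rationals \<subseteq> dyadic_rationals"
  proof (clarify)
    fix x :: real
    assume "x \<in> dyadic_rationals"
    obtain k :: int and c where "c \<in> dyadic_rationals" "pl_map A C x = 2 powi k * x + c"
      using pl_map_affine[OF A C, of "piece A x"] by metis
    then show "pl_map A C x \<in> dyadic_rationals"
      using \<open>x \<in> dyadic_rationals\<close> by simp
  qed
  show "finite ((\<lambda>j. frac (A j)) ` {0..<int N})" by simp
  show "(\<lambda>j. frac (A j)) ` {0..<int N} \<subseteq> dyadic_rationals \<inter> {0..<1}"
  proof -
    have "frac (A j) \<in> dyadic_rationals" for j
      using A unfolding frac_def by (simp add: dyadic_partition_def)
    then show ?thesis by (auto simp: frac_lt_1)
  qed
next
  fix x :: real
  define j where "j = piece A x"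
  assume x: "frac x \<notin> (\<lambda>j. frac (A j)) ` {0..<int N}"
  have "x \<noteq> A j"
  proof
    assume "x = A j"
    have N: "int N > 0" using A by (simp add: dyadic_partition_def)
    have "A j = A (j mod int N) + of_int (j div int N)"
      using partition_add_period[OF A, of "j mod int N" "j div int N"] by simp
    then have "frac x = frac (A (j mod int N))" using \<open>x = A j\<close> by (simp add: frac_def)
    then show False using x N by auto
  qed
  then have "x \<in> {A j<..<A (j + 1)}"
    using piece_bounds[OF A, of x] by (auto simp: j_def)
  then have "\<forall>\<^sub>F y in nhds x. y \<in> {A j<..<A (j + 1)}"
    by (intro eventually_nhds_in_open) auto
  then have piece: "\<forall>\<^sub>F y in nhds x. piece A y = j"
    by eventually_elim (auto intro!: piece_eq[OF A])
  obtain k :: int and c where "\<forall>x. piece A x = j \<longrightarrow> pl_map A C x = 2 powi k * x + c"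
    using pl_map_affine[OF A C, of j] by blast
  then show "\<exists>(k :: int) c. \<forall>\<^sub>F y in nhds x. pl_map A C y = 2 powi k * y + c"
    using piece by (intro exI[of _ k] exI[of _ c]) (auto elim: eventually_mono)
qed

section \<open>From lifts to permutations of the circle\<close>

definition circle_map :: "(real \<Rightarrow> real) \<Rightarrow> real \<Rightarrow> real" where
  "circle_map F = (\<lambda>x\<in>{0..<1}. frac (F x))"

lemma add_of_int_equivariant:
  fixes F :: "real \<Rightarrow> real"
  assumes "\<And>x. F (x + 1) = F x + 1"
  shows "F (x + of_int k) = F x + of_int k"
proof (induction k rule: int_induct[of _ 0])
  case (step1 i)
  then show ?case using assms[of "x + of_int i"] by (simp add: algebra_simps)
next
  case (step2 i)
  then show ?case using assms[of "x + of_int (i - 1)"] by (simp add: algebra_simps)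
qed simp

text \<open>Reducing \<open>F x\<close> modulo 1 before applying \<open>F'\<close> changes the
  result by an integer only, which the outer \<open>frac\<close> removes.\<close>

lemma circle_map_inverse:
  assumes "\<And>x. F' (F x) = x" "\<And>x. F' (x + 1) = F' x + 1" "x \<in> {0..<1}"
  shows "circle_map F' (circle_map F x) = x"
proof -
  have "F' (frac (F x)) = x + of_int (- \<lfloor>F x\<rfloor>)"
    using add_of_int_equivariant[of F' "F x" "- \<lfloor>F x\<rfloor>"] assms(1,2) by (simp add: frac_def)
  moreover have "\<lfloor>x\<rfloor> = 0" using assms(3) by (simp add: floor_eq_iff)
  ultimately have "frac (F' (frac (F x))) = x"
    by (simp add: frac_def)
  then show ?thesis using assms(3) by (simp add: circle_map_def frac_lt_1)
qed

lemma circle_map_Bij: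
  assumes "\<And>x. F' (F x) = x" "\<And>x. F (F' x) = x"
    and "\<And>x. F (x + 1) = F x + 1" "\<And>x. F' (x + 1) = F' x + 1"
  shows "circle_map F \<in> Bij {0..<1}"
    and "inv\<^bsub>BijGroup {0..<1}\<^esub> circle_map F = circle_map F'"
proof -
  have mem: "circle_map F x \<in> {0..<1}" if "x \<in> {0..<1}" for F x
    using that by (simp add: circle_map_def frac_lt_1)
  have ext: "circle_map F \<in> extensional {0..<1}" for F by (simp add: circle_map_def)
  have inv: "circle_map F' (circle_map F x) = x" "circle_map F (circle_map F' x) = x"
    if "x \<in> {0..<1}" for x
    using circle_map_inverse[of F' F x] circle_map_inverse[of F F' x] assms that by auto
  have bij: "bij_betw (circle_map F) {0..<1} {0..<1}" "bij_betw (circle_map F') {0..<1} {0..<1}"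
    by (rule bij_betwI[of _ _ _ "circle_map F'"], use inv mem in auto)
      (rule bij_betwI[of _ _ _ "circle_map F"], use inv mem in auto)
  then show "circle_map F \<in> Bij {0..<1}" using ext by (simp add: Bij_def)
  moreover have "circle_map F' \<in> Bij {0..<1}" using bij ext by (simp add: Bij_def)
  moreover have "compose {0..<1} (circle_map F') (circle_map F) = (\<lambda>x\<in>{0..<1}. x)"
    using inv by (auto simp: compose_def fun_eq_iff)
  ultimately show "inv\<^bsub>BijGroup {0..<1}\<^esub> circle_map F = circle_map F'"
    by (intro group.inv_equality[OF group_BijGroup]) (simp_all add: BijGroup_def)
qed

lemma circle_map_pl_map_in_thompson_T:
  assumes "dyadic_partition N A" "dyadic_partition N C"
  shows "circle_map (pl_map A C) \<in> carrier thompson_T"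
proof -
  have "circle_map (pl_map A C) \<in> Bij {0..<1}"
    using assms by (intro circle_map_Bij(1)[of "pl_map C A"]) (auto simp: pl_map_inverse pl_map_add_1)
  then show ?thesis
    using thompson_lift_pl_map[OF assms] by (auto simp: thompson_T_def circle_map_def)
qed

section \<open>The leaves of a tree as a periodic partition\<close>

lemma length_subdivision [simp]: "length (subdivision t a b) = size t + 1"
  by (induction t a b rule: subdivision.induct) auto

lemma subdivision_dyadic:
  assumes "(c, d) \<in> set (subdivision t a b)" "a \<in> dyadic_rationals" "b \<in> dyadic_rationals"
  shows "c \<in> dyadic_rationals \<and> d \<in> dyadic_rationals"
  using assms by (induction t a b rule: subdivision.induct) auto

lemma subdivision_width:
  assumes "(c, d) \<in> set (subdivision t a b)"
  shows "\<exists>k :: int. d - c = (b - a) * 2 powi k"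
  using assms
proof (induction t a b rule: subdivision.induct)
  case (1 a b)
  then show ?case by (intro exI[of _ 0]) auto
next
  case (2 l v r a b)
  then obtain k :: int where "d - c = ((b - a) / 2) * 2 powi k"
    by (auto simp: field_simps)
  then show ?case by (intro exI[of _ "k - 1"]) (simp add: power_int_diff)
qed

lemma subdivision_first: "fst (subdivision t a b ! 0) = a"
  by (induction t a b rule: subdivision.induct) (auto simp: nth_append)

text \<open>Adjacent leaves share an endpoint, so the left endpoints alone carry the whole
  subdivision; \<open>leaf_partition\<close> records only these.\<close>

lemma subdivision_consecutive:
  assumes "j \<le> size t"
  shows "snd (subdivision t a b ! j) = (if j = size t then b else fst (subdivision t a b ! Suc j))"
  using assms
proof (induction t a b arbitrary: j rule: subdivision.induct)
  case (2 l v r a b)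
  show ?case
  proof (cases "j \<le> size l")
    case True
    then show ?thesis
      using "2.IH"(1)[of j] subdivision_first[of r] by (auto simp: nth_append)
  next
    case False
    then show ?thesis
      using "2.IH"(2)[of "j - Suc (size l)"] "2.prems"
      by (auto simp: nth_append Suc_diff_Suc not_le)
  qed
qed simp

lemma subdivision_subset:
  assumes "(c, d) \<in> set (subdivision t a b)" "a \<le> b"
  shows "a \<le> c \<and> d \<le> b"
  using assms by (induction t a b rule: subdivision.induct) (auto; linarith?)+

definition leaf_partition :: "unit tree \<Rightarrow> int \<Rightarrow> real" where
  "leaf_partition t j = fst (leaf_intervals t ! nat (j mod (size t + 1))) + of_int (j div (size t + 1))"

lemma leaf_partition_Suc:
  "leaf_partition t (j + 1) =
     snd (leaf_intervals t ! nat (j mod (size t + 1))) + of_int (j div (size t + 1))"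
proof -
  let ?N = "1 + int (size t)"
  define q r where "q = j div ?N" and "r = nat (j mod ?N)"
  have r: "r \<le> size t" using pos_mod_bound[of ?N j] unfolding r_def by linarith
  have j: "j = int r + q * ?N" using mod_div_mult_eq[of j ?N] by (simp add: q_def r_def)
  show ?thesis
  proof (cases "r = size t")
    \<comment> \<open>At the last leaf the index wraps to leaf 0 of the next period, and the right
      endpoint 1 is the left endpoint 0 moved by one period.\<close>
    case True
    then have "j + 1 = (q + 1) * ?N" using j by (simp add: algebra_simps)
    then have "(j + 1) mod ?N = 0" "(j + 1) div ?N = q + 1" by simp_all
    then show ?thesis
      using subdivision_consecutive[OF r, of 0 1] subdivision_first[of t 0 1] True
      by (simp add: leaf_partition_def leaf_intervals_def q_def[symmetric] r_def[symmetric])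
  next
    case False
    then have "j + 1 = int (Suc r) + q * ?N" "int (Suc r) < ?N" using j r by auto
    then have "(j + 1) mod ?N = int (Suc r)" "(j + 1) div ?N = q"
      by (simp_all only: mod_mult_self1 div_mult_self1) (simp_all add: div_pos_pos_trivial)
    then show ?thesis
      using subdivision_consecutive[OF r, of 0 1] False
      by (simp add: leaf_partition_def leaf_intervals_def q_def[symmetric] r_def[symmetric] nat_add_distrib)
  qed
qed

lemma dyadic_partition_leaf: "dyadic_partition (size t + 1) (leaf_partition t)"
  unfolding dyadic_partition_def
proof (intro conjI allI)
  fix j :: int
  let ?p = "leaf_intervals t ! nat (j mod (size t + 1))"
  have "nat (j mod (size t + 1)) < size t + 1"
    using pos_mod_bound[of "int (size t + 1)" j] by (simp add: nat_less_iff)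
  then have p: "?p \<in> set (subdivision t 0 1)" by (simp add: leaf_intervals_def)
  show "leaf_partition t j \<in> dyadic_rationals"
    using subdivision_dyadic[of "fst ?p" "snd ?p" t 0 1] p by (simp add: leaf_partition_def)
  show "\<exists>k :: int. leaf_partition t (j + 1) - leaf_partition t j = 2 powi k"
    using subdivision_width[of "fst ?p" "snd ?p" t 0 1] p
    by (simp add: leaf_partition_Suc) (simp add: leaf_partition_def)
qed (simp_all add: leaf_partition_def)

lemma leaf_partition_0: "leaf_partition t 0 = 0"
  using subdivision_first[of t 0 1] by (simp add: leaf_partition_def leaf_intervals_def)

lemma leaf_interval_eq:
  assumes "j \<le> size t"
  shows "leaf_intervals t ! j = (leaf_partition t (int j), leaf_partition t (int j + 1))"
proof -
  have "int j mod (1 + int (size t)) = int j" "int j div (1 + int (size t)) = 0"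
    using assms by (auto intro: mod_pos_pos_trivial div_pos_pos_trivial)
  then show ?thesis
    using leaf_partition_Suc[of t "int j"] by (simp add: leaf_partition_def prod_eq_iff)
qed

lemma leaf_at_eq:
  assumes "x \<in> {0..<1}"
  shows "int (leaf_at t x) = piece (leaf_partition t) x" and "leaf_at t x \<le> size t"
proof -
  let ?A = "leaf_partition t" and ?p = "piece (leaf_partition t) x"
  note A = dyadic_partition_leaf[of t]
  \<comment> \<open>The index one past the last leaf has left endpoint 1, so a point below 1 lies in
    a piece numbered at most \<open>size t\<close>.\<close>
  have "?A (int (size t + 1)) = 1"
    using partition_add_period[OF A, of 0 1] leaf_partition_0 by simp
  then have "\<not> int (size t + 1) \<le> ?p" "0 \<le> ?p"
    using assms leaf_partition_0[of t] by (simp_all flip: piece_le_iff[OF A])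
  then have p: "nat ?p \<le> size t" "int (nat ?p) = ?p" by auto
  have "leaf_at t x = nat ?p"
    unfolding leaf_at_def
  proof (rule the_equality)
    show "nat ?p \<le> size t \<and> (case leaf_intervals t ! nat ?p of (a, b) \<Rightarrow> x \<in> {a..<b})"
      using p piece_bounds[OF A, of x] by (simp add: leaf_interval_eq)
  next
    fix j
    assume "j \<le> size t \<and> (case leaf_intervals t ! j of (a, b) \<Rightarrow> x \<in> {a..<b})"
    then have "?p = int j"
      by (intro piece_eq[OF A]) (auto simp: leaf_interval_eq)
    then show "j = nat ?p" by simp
  qed
  then show "int (leaf_at t x) = piece ?A x" "leaf_at t x \<le> size t" using p by auto
qed

lemma leaf_at_mem:
  assumes "x \<in> {0..<1}" "leaf_intervals t ! leaf_at t x = (a, b)"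
  shows "x \<in> {a..<b}"
  using leaf_at_eq[OF assms(1), of t] assms(2) piece_bounds[OF dyadic_partition_leaf[of t], of x]
  by (auto simp: leaf_interval_eq)

lemma represented_in_leaf:
  assumes "size R = size S" "x \<in> {0..<1}"
  obtains j c d where "j = leaf_at S x" "leaf_intervals R ! ((i + j) mod (size S + 1)) = (c, d)"
    "represented (S, R, i) x \<in> {c..<d}"
proof -
  define j where "j = leaf_at S x"
  obtain a b where ab: "leaf_intervals S ! j = (a, b)" by fastforce
  define m where "m = (i + j) mod (size S + 1)"
  obtain c d where cd: "leaf_intervals R ! m = (c, d)" by fastforce
  have "m \<le> size R" using assms(1) by (simp add: m_def less_Suc_eq_le[symmetric] del: less_Suc_eq_le)
  then have "c < d" using cd partition_less_step[OF dyadic_partition_leaf] by (auto simp: leaf_interval_eq)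
  have x: "a \<le> x" "x < b" using leaf_at_mem[OF assms(2), of S a b] ab by (auto simp: j_def)
  define s where "s = (x - a) / (b - a)"
  have s: "0 \<le> s" "s < 1" using x by (auto simp: s_def)
  have "0 \<le> (d - c) * s" "(d - c) * s < (d - c) * 1"
    using \<open>c < d\<close> s by (simp, intro mult_strict_left_mono) auto
  moreover have "represented (S, R, i) x = c + (d - c) * s"
    using assms ab cd by (simp add: Let_def j_def[symmetric] m_def s_def)
  ultimately have "represented (S, R, i) x \<in> {c..<d}" by (simp del: represented.simps)
  then show ?thesis using that j_def cd m_def by blast
qed

text \<open>Where the leaf number \<open>i + j\<close> is reduced modulo the number of leaves, the
  lift keeps the quotient as an integer translation, and passing to the circle forgets it.\<close>

lemma represented_eq_circle_map:
  assumes "size R = size S"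
  shows "represented (S, R, i) =
    circle_map (pl_map (leaf_partition S) (\<lambda>j. leaf_partition R (j + int i)))"
proof
  fix x
  let ?A = "leaf_partition S" and ?C = "\<lambda>j. leaf_partition R (j + int i)"
  show "represented (S, R, i) x = circle_map (pl_map ?A ?C) x"
  proof (cases "x \<in> {0..<1 :: real}")
    case True
    define j where "j = leaf_at S x"
    obtain a b where ab: "leaf_intervals S ! j = (a, b)" by fastforce
    define m where "m = (i + j) mod (size S + 1)"
    obtain c d where cd: "leaf_intervals R ! m = (c, d)" by fastforce
    have j: "int j = piece ?A x" "j \<le> size S" using leaf_at_eq[OF True] by (simp_all add: j_def)
    define q where "q = (int j + int i) div (size S + 1)"
    have m: "(int j + int i) mod (1 + int (size S)) = int m"
      by (simp add: m_def zmod_int add.commute)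
    have C: "?C (int j) = c + of_int q" "?C (int j + 1) = d + of_int q"
    proof -
      show "?C (int j) = c + of_int q"
        using assms cd m by (simp add: leaf_partition_def q_def)
      show "?C (int j + 1) = d + of_int q"
        using assms cd m leaf_partition_Suc[of R "int j + int i"] by (simp add: q_def add.assoc add.commute[of 1])
    qed
    have A: "?A (int j) = a" "?A (int j + 1) = b" using ab j by (simp_all add: leaf_interval_eq)
    have rep: "represented (S, R, i) x = c + (d - c) * ((x - a) / (b - a))"
      using True ab cd by (simp add: Let_def j_def[symmetric] m_def)
    have "pl_map ?A ?C x = represented (S, R, i) x + of_int q"
      using A C by (simp only: pl_map_def Let_def j(1)[symmetric] rep) simp
    moreover have "represented (S, R, i) x \<in> {0..<1}"
    proof -
      have "represented (S, R, i) x \<in> {c..<d}"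
        using represented_in_leaf[OF assms True, of i] cd by (metis j_def m_def prod.inject)
      moreover have "m \<le> size R" using assms by (simp add: m_def less_Suc_eq_le[symmetric] del: less_Suc_eq_le)
      then have "(c, d) \<in> set (subdivision R 0 1)"
        using cd by (metis leaf_intervals_def length_subdivision less_Suc_eq_le Suc_eq_plus1 nth_mem)
      then have "0 \<le> c" "d \<le> 1" using subdivision_subset by fastforce+
      ultimately show ?thesis by auto
    qed
    ultimately show ?thesis using True
      by (simp add: circle_map_def frac_def floor_eq_iff del: represented.simps)
  qed (auto simp: circle_map_def)
qed

text \<open>The inverse is obtained by exchanging the two partitions. Its membership is recorded
  because the letters of both signs must lie in the reduced carrier when \<open>free\<close> is
  applied.\<close>

lemma represented_in_thompson_T:
  assumes "D \<in> diagrams"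
  shows "represented D \<in> Bij {0..<1}" "represented D \<in> carrier thompson_T"
    "inv\<^bsub>BijGroup {0..<1}\<^esub> represented D \<in> carrier thompson_T"
proof -
  obtain S R i where D: "D = (S, R, i)" "size R = size S"
    using assms by (auto simp: diagrams_def diagrams_of_size_def)
  let ?A = "leaf_partition S" and ?C = "\<lambda>j. leaf_partition R (j + int i)"
  have A: "dyadic_partition (size S + 1) ?A" by (rule dyadic_partition_leaf)
  have C: "dyadic_partition (size S + 1) ?C"
    using dyadic_partition_shift dyadic_partition_leaf[of R] D(2) by metis
  have rep: "represented D = circle_map (pl_map ?A ?C)" using represented_eq_circle_map D by simp
  show "represented D \<in> Bij {0..<1}"
    unfolding rep by (rule circle_map_Bij(1)[of "pl_map ?C ?A"])
      (auto simp: pl_map_inverse[OF A C] pl_map_inverse[OF C A] pl_map_add_1[OF A C] pl_map_add_1[OF C A])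
  show "represented D \<in> carrier thompson_T"
    unfolding rep using A C by (rule circle_map_pl_map_in_thompson_T)
  have "inv\<^bsub>BijGroup {0..<1}\<^esub> represented D = circle_map (pl_map ?C ?A)"
    unfolding rep by (rule circle_map_Bij(2))
      (auto simp: pl_map_inverse[OF A C] pl_map_inverse[OF C A] pl_map_add_1[OF A C] pl_map_add_1[OF C A])
  then show "inv\<^bsub>BijGroup {0..<1}\<^esub> represented D \<in> carrier thompson_T"
    using circle_map_pl_map_in_thompson_T[OF C A] by simp
qed

section \<open>Random trees\<close>

definition trees :: "nat \<Rightarrow> unit tree set" where
  "trees n = {t. size t = n}"

abbreviation num_trees :: "nat \<Rightarrow> nat" where
  "num_trees n \<equiv> card (trees n)"

lemma trees_0: "trees 0 = {\<langle>\<rangle>}"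
  by (auto simp: trees_def)

lemma trees_Suc:
  "trees (Suc n) = (\<lambda>(k, l, r). \<langle>l, (), r\<rangle>) ` (SIGMA k:{..n}. trees k \<times> trees (n - k))"
proof (intro equalityI subsetI)
  fix t
  assume "t \<in> trees (Suc n)"
  then obtain l r where t: "t = \<langle>l, (), r\<rangle>" "size l + size r = n"
    by (cases t) (auto simp: trees_def)
  then have "(size l, l, r) \<in> (SIGMA k:{..n}. trees k \<times> trees (n - k))"
    by (auto simp: trees_def)
  then show "t \<in> (\<lambda>(k, l, r). \<langle>l, (), r\<rangle>) ` (SIGMA k:{..n}. trees k \<times> trees (n - k))"
    using t(1) by force
qed (auto simp: trees_def)

lemma finite_trees [simp]: "finite (trees n)"
proof (induction n rule: less_induct)
  case (less n)
  then show ?case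
    by (cases n) (auto simp: trees_0 trees_Suc intro!: finite_imageI finite_SigmaI)
qed

lemma num_trees_0: "num_trees 0 = 1"
  by (simp add: trees_0)

lemma num_trees_Suc: "num_trees (Suc n) = (\<Sum>k\<le>n. num_trees k * num_trees (n - k))"
proof -
  have "inj_on (\<lambda>(k, l, r). \<langle>l, (), r\<rangle>) (SIGMA k:{..n}. trees k \<times> trees (n - k))"
    by (auto simp: inj_on_def trees_def)
  then show ?thesis
    by (simp add: trees_Suc card_image card_cartesian_product)
qed

text \<open>
  The generating function \<open>T = 1 + X T\<^sup>2\<close> gives \<open>Y = 1 - 2 X T\<close> with \<open>Y\<^sup>2 = 1 - 4 X\<close>; differentiating
  yields the linear equation \<open>(1 - 4 X) Y' = - 2 Y\<close>, from which the recurrence is read off.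
\<close>

lemma num_trees_recurrence:
  "(real n + 2) * real (num_trees (Suc n)) = (4 * real n + 2) * real (num_trees n)"
proof -
  define T :: "real fps" where "T = Abs_fps (\<lambda>n. real (num_trees n))"
  have T: "T = 1 + fps_X * T\<^sup>2"
  proof (rule fps_ext)
    fix n
    show "fps_nth T n = fps_nth (1 + fps_X * T\<^sup>2) n"
    proof (cases n)
      case (Suc m)
      have "(\<Sum>k\<le>m. real (num_trees k) * real (num_trees (m - k))) = fps_nth (T\<^sup>2) m"
        by (simp add: power2_eq_square fps_mult_nth T_def atMost_atLeast0)
      then show ?thesis
        using Suc by (simp add: T_def num_trees_Suc)
    qed (simp add: T_def num_trees_0)
  qed
  define Y where "Y = 1 - 2 * fps_X * T"
  have "Y\<^sup>2 = 1 - 4 * fps_X * (T - fps_X * T\<^sup>2)"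
    by (simp add: Y_def power2_eq_square algebra_simps)
  then have Y2: "Y\<^sup>2 = 1 - 4 * fps_X" using T by (metis add_diff_cancel_right' mult.right_neutral)
  have "2 * Y * fps_deriv Y = fps_deriv (Y\<^sup>2)"
    by (simp add: power2_eq_square algebra_simps)
  also have "\<dots> = - 4" by (simp add: Y2)
  \<comment> \<open>The extra factor \<open>Y\<close> completes \<open>Y * Y\<close>, which can then
    be replaced by \<open>1 - 4 * fps_X\<close>.\<close>
  finally have "Y * (2 * Y * fps_deriv Y) = Y * (- 4)" by simp
  then have "2 * ((1 - 4 * fps_X) * fps_deriv Y) = 2 * (- 2 * Y)"
    unfolding Y2[symmetric] by (simp add: power2_eq_square mult_ac)
  then have "(1 - 4 * fps_X) * fps_deriv Y = - 2 * Y"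
    by (subst (asm) mult_cancel_left) simp
  then have "fps_deriv Y - 4 * (fps_X * fps_deriv Y) = - 2 * Y" by (simp add: algebra_simps)
  then have "fps_nth (fps_deriv Y - 4 * (fps_X * fps_deriv Y)) (Suc n) = fps_nth (- 2 * Y) (Suc n)" by simp
  moreover have "fps_nth Y (Suc m) = - 2 * real (num_trees m)" for m
    by (simp add: Y_def T_def mult.assoc fps_numeral_fps_const)
  ultimately show ?thesis
    by (simp add: fps_numeral_fps_const algebra_simps)
qed

lemma num_trees_pos: "num_trees n > 0"
proof (induction n)
  case (Suc n)
  then have "(real n + 2) * real (num_trees (Suc n)) > 0"
    by (subst num_trees_recurrence) simp
  then show ?case by (simp add: zero_less_mult_iff)
qed (simp add: num_trees_0)

lemma num_trees_ratio:
  "(\<lambda>n. real (num_trees n) / real (num_trees (n + m))) \<longlonglongrightarrow> (1 / 4) ^ m"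
proof (induction m)
  case 0
  then show ?case using num_trees_pos by (simp add: less_imp_neq[symmetric])
next
  case (Suc m)
  have "real (num_trees n) / real (num_trees (Suc n)) = (real n + 2) / (4 * real n + 2)" for n
    using num_trees_recurrence[of n] num_trees_pos[of "Suc n"]
    by (subst frac_eq_eq) (auto simp: mult.commute add_nonneg_eq_0_iff)
  moreover have "(\<lambda>n. (real n + 2) / (4 * real n + 2)) \<longlonglongrightarrow> 1 / 4" by real_asymp
  ultimately have "(\<lambda>n. real (num_trees n) / real (num_trees (Suc n))) \<longlonglongrightarrow> 1 / 4" by simp
  then have "(\<lambda>n. real (num_trees (n + m)) / real (num_trees (Suc (n + m)))) \<longlonglongrightarrow> 1 / 4"
    by (rule LIMSEQ_ignore_initial_segment)
  from tendsto_mult[OF Suc this] show ?case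
    using num_trees_pos by (simp add: less_imp_neq[symmetric] mult.commute)
qed

text \<open>\<open>(real L + 1) * num_trees L\<close> is the central binomial coefficient of
  \<open>2 * L\<close>. The closed form telescopes by the recurrence.\<close>

lemma sum_num_trees:
  "(\<Sum>k<L. real (num_trees k) / 4 ^ Suc k) = (1 - (real L + 1) * real (num_trees L) / 4 ^ L) / 2"
proof (induction L)
  case (Suc L)
  define x where "x = real (num_trees L) / 4 ^ L"
  have "(real (Suc L) + 1) * real (num_trees (Suc L)) = (4 * real L + 2) * real (num_trees L)"
    using num_trees_recurrence[of L] by (simp add: add.commute)
  then have "(real (Suc L) + 1) * real (num_trees (Suc L)) / 4 ^ Suc L = (real L + 1 / 2) * x"
    by (simp only: x_def) (simp add: field_simps)
  moreover have "(\<Sum>k<Suc L. real (num_trees k) / 4 ^ Suc k) = (1 - (real L + 1) * x) / 2 + x / 4"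
    by (simp only: sum.lessThan_Suc Suc x_def) simp
  ultimately show ?case by (simp only:) (simp add: field_simps)
qed (simp add: num_trees_0)

lemma sum_num_trees_tendsto:
  "(\<lambda>L. \<Sum>k<L. real (num_trees k) / 4 ^ Suc k) \<longlonglongrightarrow> 1 / 2"
proof -
  define b where "b L = (real L + 1) * real (num_trees L) / 4 ^ L" for L
  have b_Suc: "b (Suc L) = (2 * real L + 1) / (2 * real L + 2) * b L" for L
  proof -
    have "b (Suc L) = (4 * real L + 2) * real (num_trees L) / 4 ^ Suc L"
      using num_trees_recurrence[of L] by (simp add: b_def add.commute)
    also have "\<dots> = (2 * real L + 1) / (2 * real L + 2) * b L"
      by (simp add: b_def divide_simps) (simp add: algebra_simps)
    finally show ?thesis .
  qed
  \<comment> \<open>A Wallis-type bound showing that \<open>b L\<close> decays like the inverse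
    square root of \<open>L\<close>. The induction step amounts to (2L+1)(2L+3) \<le>
    (2L+2)^2.\<close>
  have "(b L)\<^sup>2 * (2 * real L + 1) \<le> 1" for L
  proof (induction L)
    case (Suc L)
    define r where "r = (2 * real L + 1) / (2 * real L + 2)"
    have "r\<^sup>2 * (2 * real L + 3) \<le> 2 * real L + 1"
      unfolding r_def by (simp add: power2_eq_square divide_simps) (simp add: algebra_simps)
    then have "(b L)\<^sup>2 * (r\<^sup>2 * (2 * real L + 3)) \<le> (b L)\<^sup>2 * (2 * real L + 1)"
      by (intro mult_left_mono) auto
    also note Suc
    finally have "(b L)\<^sup>2 * (r\<^sup>2 * (2 * real L + 3)) \<le> 1" .
    moreover have "b (Suc L) = r * b L" by (simp only: b_Suc r_def)
    ultimately have "(b (Suc L))\<^sup>2 * (2 * real L + 3) \<le> 1"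
      by (simp only: power_mult_distrib mult_ac)
    then show ?case by (simp add: algebra_simps)
  qed (simp add: b_def num_trees_0)
  then have le: "(b L)\<^sup>2 \<le> 1 / (2 * real L + 1)" for L
    by (simp add: field_simps)
  have "(\<lambda>L. (b L)\<^sup>2) \<longlonglongrightarrow> 0"
  proof (rule tendsto_sandwich)
    show "\<forall>\<^sub>F L in sequentially. 0 \<le> (b L)\<^sup>2" by simp
    show "\<forall>\<^sub>F L in sequentially. (b L)\<^sup>2 \<le> 1 / (2 * real L + 1)"
      using le by (intro always_eventually) blast
    show "(\<lambda>L. 1 / (2 * real L + 1)) \<longlonglongrightarrow> 0" by real_asymp
  qed (rule tendsto_const)
  then have "b \<longlonglongrightarrow> 0" by (simp add: power_tendsto_0_iff)
  then have "(\<lambda>L. (1 - b L) / 2) \<longlonglongrightarrow> (1 - 0) / 2" by (intro tendsto_intros) auto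
  then show ?thesis by (simp only: sum_num_trees b_def) simp
qed

section \<open>Giant subtrees and the law of their addresses\<close>

fun subtree :: "'a tree \<Rightarrow> bool list \<Rightarrow> 'a tree" where
  "subtree t [] = t"
| "subtree \<langle>\<rangle> (e # w) = \<langle>\<rangle>"
| "subtree \<langle>l, _, r\<rangle> (e # w) = subtree (if e then r else l) w"

text \<open>\<open>K\<close> bounds the number of internal nodes missing from the subtree. An
  address that runs past a leaf gives a subtree of size 0, so it qualifies only if \<open>n\<close>
  is at most \<open>K\<close>.\<close>

definition giant :: "bool list \<Rightarrow> nat \<Rightarrow> nat \<Rightarrow> unit tree set" where
  "giant w K n = {t \<in> trees n. n \<le> size (subtree t w) + K}"

lemma finite_giant [simp]: "finite (giant w K n)"
  by (simp add: giant_def)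

text \<open>Neither of two distinct addresses of equal length is a prefix of the other, so the two
  subtrees have no node in common.\<close>

lemma size_subtree_add:
  assumes "length w = length v" "w \<noteq> v"
  shows "size (subtree t w) + size (subtree t v) \<le> size t"
proof -
  have le: "size (subtree t w) \<le> size t" for t :: "'a tree" and w
  proof (induction w arbitrary: t)
    case (Cons e w)
    then show ?case by (cases t) (auto intro: le_SucI trans_le_add1 trans_le_add2)
  qed simp
  show ?thesis
    using assms
  proof (induction w v arbitrary: t rule: list_induct2)
    case (Cons e w e' v)
    show ?case
    proof (cases t)
      case (Node l x r)
      show ?thesis
      proof (cases "e = e'")
        case True
        then show ?thesis using Cons.IH[of "if e then r else l"] Cons.prems Node by auto
      next
        case False
        then show ?thesis using le[of l w] le[of r w] le[of l v] le[of r v] Node by auto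
      qed
    qed simp
  qed simp
qed

text \<open>Two giant subtrees would together have at least \<open>2 * n - 2 * K\<close> nodes,
  which is more than \<open>n\<close>.\<close>

lemma giant_disjoint:
  assumes "length w = length v" "w \<noteq> v" "2 * K < n"
  shows "giant w K n \<inter> giant v K n = {}"
proof -
  have False if "t \<in> giant w K n" "t \<in> giant v K n" for t
    using that size_subtree_add[OF assms(1,2), of t] assms(3) by (auto simp: giant_def trees_def)
  then show ?thesis by blast
qed

text \<open>The child away from \<open>e\<close> is given a size \<open>k\<close> below
  \<open>L\<close>, and the child on the side of \<open>e\<close> is giant at \<open>w\<close>.
  Besides the \<open>K\<close> nodes already missing, the root and the small child account for
  \<open>Suc k\<close>, which is at most \<open>L\<close>.\<close>

lemma card_giant_Cons:
  assumes "L \<le> n"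
  shows "(\<Sum>k<L. num_trees k * card (giant w K (n - Suc k))) \<le> card (giant (e # w) (K + L) n)"
proof -
  define P where "P = (SIGMA k:{..<L}. trees k \<times> giant w K (n - Suc k))"
  define f where "f = (\<lambda>(k :: nat, s, t). if e then Node s () t else Node t () s)"
  have "inj_on f P"
    by (auto simp: inj_on_def P_def f_def trees_def split: if_splits)
  moreover have "f ` P \<subseteq> giant (e # w) (K + L) n"
    using assms by (auto simp: P_def f_def trees_def giant_def)
  ultimately have "card P \<le> card (giant (e # w) (K + L) n)"
    by (rule card_inj_on_le) simp
  then show ?thesis by (simp add: P_def card_cartesian_product)
qed

text \<open>Each further step of the address costs a factor tending to 1/2, by
  \<open>card_giant_Cons\<close> and \<open>sum_num_trees_tendsto\<close>. The strict inequality
  leaves room for truncating the sum at \<open>L\<close> and for replacing limits by large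
  \<open>n\<close>.\<close>

lemma giant_density:
  assumes "c < (1 / 2) ^ d"
  shows "\<exists>K. \<forall>\<^sub>F n in sequentially. \<forall>w. length w = d \<longrightarrow> c * real (num_trees n) \<le> real (card (giant w K n))"
  using assms
proof (induction d arbitrary: c)
  case 0
  then have "c * real (num_trees n) \<le> 1 * real (num_trees n)" for n
    by (intro mult_right_mono) auto
  moreover have "giant [] 0 n = trees n" for n by (auto simp: giant_def trees_def)
  ultimately show ?case by (intro exI[of _ 0]) simp
next
  case (Suc d)
  then have "2 * c < (1 / 2) ^ d" by simp
  \<comment> \<open>The upper bound on \<open>c'\<close> admits the induction hypothesis; the lower
    bound is the slack spent on the factor 1/2, which is only approached.\<close>
  then obtain c' where c': "2 * c < c'" "c' < (1 / 2) ^ d" using dense by blast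
  define s where "s L = (\<Sum>k<L. real (num_trees k) / 4 ^ Suc k)" for L
  have "(\<lambda>L. c' * s L) \<longlonglongrightarrow> c' * (1 / 2)"
    unfolding s_def by (intro tendsto_mult tendsto_const sum_num_trees_tendsto)
  moreover have "c < c' * (1 / 2)" using c' by simp
  ultimately have "\<forall>\<^sub>F L in sequentially. c < c' * s L" by (rule order_tendstoD)
  then obtain L where L: "c < c' * s L" by (auto simp: eventually_sequentially)
  obtain K where K: "\<forall>\<^sub>F n in sequentially. \<forall>w. length w = d \<longrightarrow> c' * real (num_trees n) \<le> real (card (giant w K n))"
    using Suc.IH[OF c'(2)] by blast
  then obtain n0 where n0: "\<And>n w. n \<ge> n0 \<Longrightarrow> length w = d \<Longrightarrow> c' * real (num_trees n) \<le> real (card (giant w K n))"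
    by (auto simp: eventually_sequentially)
  \<comment> \<open>For \<open>n\<close> at least \<open>L\<close> this is the proportion of trees
    of size \<open>n\<close> in which a fixed child of the root has fewer than \<open>L\<close>
    nodes.\<close>
  define u where "u n = (\<Sum>k<L. real (num_trees k) * (real (num_trees (n - Suc k)) / real (num_trees n)))" for n
  have "u \<longlonglongrightarrow> s L"
    unfolding u_def s_def
  proof (intro tendsto_sum)
    fix k
    have "(\<lambda>n. real (num_trees (n + Suc k - Suc k)) / real (num_trees (n + Suc k))) \<longlonglongrightarrow> (1 / 4) ^ Suc k"
      using num_trees_ratio[of "Suc k"] by simp
    then have "(\<lambda>n. real (num_trees (n - Suc k)) / real (num_trees n)) \<longlonglongrightarrow> (1 / 4) ^ Suc k"
      by (rule LIMSEQ_offset)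
    then have "(\<lambda>n. real (num_trees k) * (real (num_trees (n - Suc k)) / real (num_trees n)))
        \<longlonglongrightarrow> real (num_trees k) * (1 / 4) ^ Suc k"
      by (intro tendsto_mult tendsto_const)
    then show "(\<lambda>n. real (num_trees k) * (real (num_trees (n - Suc k)) / real (num_trees n)))
        \<longlonglongrightarrow> real (num_trees k) / 4 ^ Suc k"
      by (simp add: power_one_over)
  qed
  then have "(\<lambda>n. c' * u n) \<longlonglongrightarrow> c' * s L" by (intro tendsto_mult tendsto_const)
  then have "\<forall>\<^sub>F n in sequentially. c < c' * u n" using L by (rule order_tendstoD)
  moreover have "\<forall>\<^sub>F n in sequentially. n \<ge> n0 + L" by (rule eventually_ge_at_top)
  ultimately have "\<forall>\<^sub>F n in sequentially. \<forall>w. length w = Suc d \<longrightarrow>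
      c * real (num_trees n) \<le> real (card (giant w (K + L) n))"
  proof eventually_elim
    case (elim n)
    show ?case
    proof (intro allI impI)
      fix w :: "bool list"
      assume "length w = Suc d"
      then obtain e v where w: "w = e # v" "length v = d" by (cases w) auto
      have "c * real (num_trees n) \<le> c' * u n * real (num_trees n)"
        using elim by (intro mult_right_mono) auto
      also have "\<dots> = (\<Sum>k<L. real (num_trees k) * (c' * real (num_trees (n - Suc k))))"
      proof -
        obtain m where "real (num_trees n) = m" "m > 0" using num_trees_pos[of n] by simp
        then show ?thesis by (simp add: u_def sum_distrib_left sum_distrib_right mult_ac)
      qed
      also have "\<dots> \<le> (\<Sum>k<L. real (num_trees k) * real (card (giant v K (n - Suc k))))"
        using elim w by (intro sum_mono mult_left_mono n0) auto
      also have "\<dots> = real (\<Sum>k<L. num_trees k * card (giant v K (n - Suc k)))" by simp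
      also have "\<dots> \<le> real (card (giant w (K + L) n))"
        using card_giant_Cons[of L n v K e] elim w by (simp only: of_nat_le_iff)
      finally show "c * real (num_trees n) \<le> real (card (giant w (K + L) n))" .
    qed
  qed
  then show ?case by blast
qed

section \<open>Random diagrams\<close>

fun cell :: "bool list \<Rightarrow> real \<Rightarrow> real \<Rightarrow> real set" where
  "cell [] a b = {a..<b}"
| "cell (e # w) a b = (if e then cell w ((a + b) / 2) b else cell w a ((a + b) / 2))"

lemma cell_subset: "a \<le> b \<Longrightarrow> cell w a b \<subseteq> {a..<b}"
proof (induction w arbitrary: a b)
  case (Cons e w)
  have "cell w ((a + b) / 2) b \<subseteq> {(a + b) / 2..<b}" "cell w a ((a + b) / 2) \<subseteq> {a..<(a + b) / 2}"
    using Cons by auto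
  moreover have "{(a + b) / 2..<b} \<subseteq> {a..<b}" "{a..<(a + b) / 2} \<subseteq> {a..<b}"
    using Cons.prems by auto
  ultimately show ?case by (simp only: cell.simps split: if_split) blast
qed simp

lemma cell_nonempty: "a < b \<Longrightarrow> cell w a b \<noteq> {}"
  by (induction w arbitrary: a b) auto

lemma cell_disjoint:
  assumes "length w = length v" "w \<noteq> v" "a \<le> b"
  shows "cell w a b \<inter> cell v a b = {}"
  using assms
proof (induction w v arbitrary: a b rule: list_induct2)
  case (Cons e w e' v)
  have m: "a \<le> (a + b) / 2" "(a + b) / 2 \<le> b" using Cons.prems by auto
  show ?case
  proof (cases "e = e'")
    case True
    then show ?thesis
      using Cons.IH[of a "(a + b) / 2"] Cons.IH[of "(a + b) / 2" b] Cons.prems m by auto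
  next
    case False
    have "cell u a ((a + b) / 2) \<inter> cell u' ((a + b) / 2) b = {}" for u u'
      using cell_subset[OF m(1), of u] cell_subset[OF m(2), of u'] by fastforce
    with False show ?thesis by (auto simp: Int_commute)
  qed
qed simp

text \<open>The leaves below a node are consecutive. A subtree that is a leaf is excluded because
  the address may have run past that leaf, whose interval would then be larger than the
  cell.\<close>

lemma subdivision_subtree:
  assumes "subtree t w \<noteq> \<langle>\<rangle>" "a \<le> b"
  shows "\<exists>us ms vs. subdivision t a b = us @ ms @ vs \<and> length ms = size (subtree t w) + 1 \<and>
    (\<forall>(c, d)\<in>set ms. {c..<d} \<subseteq> cell w a b)"
  using assms
proof (induction w arbitrary: t a b)
  case Nil
  have "{c..<d} \<subseteq> {a..<b}" if "(c, d) \<in> set (subdivision t a b)" for c d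
    using subdivision_subset[OF that Nil(2)] by auto
  then show ?case
    by (intro exI[of _ "[]"] exI[of _ "subdivision t a b"]) auto
next
  case (Cons e w)
  then obtain l x r where t: "t = \<langle>l, x, r\<rangle>" by (cases t) auto
  let ?m = "(a + b) / 2"
  show ?case
  proof (cases e)
    case True
    then obtain us ms vs where "subdivision r ?m b = us @ ms @ vs" "length ms = size (subtree r w) + 1"
      "\<forall>(c, d)\<in>set ms. {c..<d} \<subseteq> cell w ?m b"
      using Cons.IH[of r ?m b] Cons.prems t by auto
    then show ?thesis
      using True t by (intro exI[of _ "subdivision l a ?m @ us"] exI[of _ ms] exI[of _ vs]) simp
  next
    case False
    then obtain us ms vs where "subdivision l a ?m = us @ ms @ vs" "length ms = size (subtree l w) + 1"
      "\<forall>(c, d)\<in>set ms. {c..<d} \<subseteq> cell w a ?m"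
      using Cons.IH[of l a ?m] Cons.prems t by auto
    then show ?thesis
      using False t by (intro exI[of _ us] exI[of _ ms] exI[of _ "vs @ subdivision r ?m b"]) simp
  qed
qed

section \<open>Leaves outside a cell and marks that avoid collisions\<close>

definition outside :: "bool list \<Rightarrow> unit tree \<Rightarrow> nat set" where
  "outside w t = {j. j \<le> size t \<and> (case leaf_intervals t ! j of (a, b) \<Rightarrow> \<not> {a..<b} \<subseteq> cell w 0 1)}"

lemma finite_outside [simp]: "finite (outside w t)"
  by (rule finite_subset[of _ "{..size t}"]) (auto simp: outside_def)

text \<open>Of the \<open>n + 1\<close> leaves, the block below the giant node takes at least
  \<open>n + 1 - K\<close>.\<close>

lemma card_outside:
  assumes "t \<in> giant w K n" "K < n"
  shows "card (outside w t) \<le> K"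
proof -
  have t: "size t = n" "n \<le> size (subtree t w) + K"
    using assms by (auto simp: giant_def trees_def)
  then have "subtree t w \<noteq> \<langle>\<rangle>" using assms(2) by auto
  then obtain us ms vs where s: "leaf_intervals t = us @ ms @ vs" "length ms = size (subtree t w) + 1"
    "\<forall>(c, d)\<in>set ms. {c..<d} \<subseteq> cell w 0 1"
    using subdivision_subtree[of t w 0 1] by (auto simp: leaf_intervals_def)
  have len: "length (leaf_intervals t) = n + 1" using t by (simp add: leaf_intervals_def)
  have "outside w t \<subseteq> {..n} - {length us..<length us + length ms}"
  proof
    fix j
    assume j: "j \<in> outside w t"
    have False if "length us \<le> j" "j < length us + length ms"
    proof -
      have "leaf_intervals t ! j \<in> set ms" using that s(1) by (auto simp: nth_append)
      then have "case leaf_intervals t ! j of (c, d) \<Rightarrow> {c..<d} \<subseteq> cell w 0 1"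
        by (rule bspec[OF s(3)])
      then show False using j by (simp add: outside_def case_prod_beta)
    qed
    then show "j \<in> {..n} - {length us..<length us + length ms}"
      using j t by (auto simp: outside_def)
  qed
  then have "card (outside w t) \<le> card ({..n} - {length us..<length us + length ms})"
    by (intro card_mono) auto
  also have "\<dots> = (n + 1) - length ms"
    using len s(1) by (subst card_Diff_subset) auto
  also have "\<dots> \<le> K" using t s(2) by simp
  finally show ?thesis .
qed

definition good_marks :: "bool list \<Rightarrow> bool list \<Rightarrow> unit tree \<Rightarrow> unit tree \<Rightarrow> nat set" where
  "good_marks w v S R =
     {i. i \<le> size S \<and> (\<forall>j\<in>outside w S. (i + j) mod (size S + 1) \<notin> outside v R)}"

text \<open>A bad mark sends some outside leaf \<open>j\<close> of \<open>S\<close> to some outside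
  leaf \<open>j'\<close> of \<open>R\<close>. This pair determines the mark, and there are at most
  \<open>K * K\<close> pairs.\<close>

lemma card_good_marks:
  assumes "S \<in> giant w K n" "R \<in> giant v K n" "K < n"
  shows "(n + 1) - K\<^sup>2 \<le> card (good_marks w v S R)"
proof -
  have n: "size S = n" "size R = n" using assms by (auto simp: giant_def trees_def)
  let ?P = "outside w S \<times> outside v R"
  \<comment> \<open>This is \<open>j' - j\<close> modulo the number of leaves; adding
    \<open>n + 1\<close> first avoids truncated subtraction.\<close>
  let ?f = "\<lambda>(j, j'). (j' + (n + 1) - j) mod (n + 1)"
  have "{..n} - good_marks w v S R \<subseteq> ?f ` ?P"
  proof
    fix i
    assume "i \<in> {..n} - good_marks w v S R"
    then obtain j where j: "i \<le> n" "j \<in> outside w S" "(i + j) mod (n + 1) \<in> outside v R"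
      using n by (auto simp: good_marks_def)
    have "j \<le> n" using j n by (simp add: outside_def)
    have "((i + j) mod (n + 1) + (n + 1) - j) mod (n + 1) = i"
    proof (cases "i + j < n + 1")
      case True
      then have "(i + j) mod (n + 1) + (n + 1) - j = i + (n + 1)" by simp
      then show ?thesis using j(1) by (simp only: mod_add_self2) simp
    next
      case False
      then have "(i + j) mod (n + 1) = i + j - (n + 1)"
        using j(1) \<open>j \<le> n\<close> by (subst mod_if) simp
      then show ?thesis using j(1) False by simp
    qed
    then show "i \<in> ?f ` ?P" using j by force
  qed
  then have "card ({..n} - good_marks w v S R) \<le> card (?f ` ?P)"
    by (intro card_mono) auto
  also have "\<dots> \<le> card ?P" by (intro card_image_le) simp
  also have "\<dots> \<le> K * K"
    using card_outside[OF assms(1,3)] card_outside[OF assms(2,3)]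
    by (simp add: card_cartesian_product mult_le_mono)
  finally have "card ({..n} - good_marks w v S R) \<le> K\<^sup>2" by (simp add: power2_eq_square)
  moreover have "good_marks w v S R \<subseteq> {..n}" using n by (auto simp: good_marks_def)
  then have "card ({..n} - good_marks w v S R) = (n + 1) - card (good_marks w v S R)"
    by (subst card_Diff_subset) (auto intro: finite_subset)
  ultimately show ?thesis by simp
qed

definition squeezing :: "nat \<Rightarrow> bool list \<Rightarrow> bool list \<Rightarrow> nat \<Rightarrow> tree_pair set" where
  "squeezing K w v n = (SIGMA S:giant w K n. SIGMA R:giant v K n. good_marks w v S R)"

lemma squeezing_subset: "squeezing K w v n \<subseteq> diagrams_of_size n"
  by (auto simp: squeezing_def diagrams_of_size_def giant_def trees_def good_marks_def)

lemma finite_diagrams_of_size [simp]: "finite (diagrams_of_size n)"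
proof -
  have "diagrams_of_size n = trees n \<times> trees n \<times> {..n}"
    by (auto simp: diagrams_of_size_def trees_def)
  then show ?thesis by simp
qed

lemma card_diagrams_of_size: "card (diagrams_of_size n) = num_trees n * (num_trees n * (n + 1))"
proof -
  have "diagrams_of_size n = trees n \<times> trees n \<times> {..n}"
    by (auto simp: diagrams_of_size_def trees_def)
  then show ?thesis by (simp add: card_cartesian_product)
qed

lemma finite_good_marks [simp]: "finite (good_marks w v S R)"
  by (rule finite_subset[of _ "{..size S}"]) (auto simp: good_marks_def)

lemma card_squeezing:
  assumes "K < n"
  shows "card (giant w K n) * (card (giant v K n) * ((n + 1) - K\<^sup>2)) \<le> card (squeezing K w v n)"
proof -
  have "card (giant v K n) * ((n + 1) - K\<^sup>2) \<le> card (SIGMA R:giant v K n. good_marks w v S R)"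
    if "S \<in> giant w K n" for S
    using sum_bounded_below[of "giant v K n" "(n + 1) - K\<^sup>2" "\<lambda>R. card (good_marks w v S R)"]
      card_good_marks[OF that _ assms] by simp
  then show ?thesis
    using sum_bounded_below[of "giant w K n" "card (giant v K n) * ((n + 1) - K\<^sup>2)"
        "\<lambda>S. card (SIGMA R:giant v K n. good_marks w v S R)"]
    by (simp add: squeezing_def finite_SigmaI)
qed

text \<open>A leaf containing a point off the cell of \<open>w\<close> counts as outside, even if it
  overlaps the cell. A good mark sends it to a leaf contained in the cell of
  \<open>v\<close>.\<close>

lemma squeezing_maps:
  assumes "D \<in> squeezing K w v n" "x \<in> {0..<1}" "x \<notin> cell w 0 1"
  shows "represented D x \<in> cell v 0 1"
proof -
  obtain S R i where D: "D = (S, R, i)" by (cases D)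
  have n: "size S = n" "size R = n" and i: "i \<in> good_marks w v S R"
    using assms(1) by (auto simp: D squeezing_def giant_def trees_def)
  obtain j c d where j: "j = leaf_at S x" "leaf_intervals R ! ((i + j) mod (size S + 1)) = (c, d)"
    "represented (S, R, i) x \<in> {c..<d}"
    using represented_in_leaf[of R S x i] n assms(2) by auto
  obtain a b where ab: "leaf_intervals S ! j = (a, b)" by fastforce
  then have "x \<in> {a..<b}" using leaf_at_mem[OF assms(2)] j(1) by blast
  then have "j \<in> outside w S"
    using ab assms(3) leaf_at_eq(2)[OF assms(2), of S] j(1) by (auto simp: outside_def)
  then have "(i + j) mod (size S + 1) \<notin> outside v R" using i by (auto simp: good_marks_def)
  moreover have "(i + j) mod (size S + 1) \<le> size R" using n by (simp add: less_Suc_eq_le[symmetric] del: less_Suc_eq_le)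
  ultimately have "{c..<d} \<subseteq> cell v 0 1" using j(2) by (simp add: outside_def)
  then show ?thesis using j(3) D by blast
qed

text \<open>Ping-pong with four cells: each generator squeezes the complement of its source cell
  into its target cell, and its inverse goes the other way.\<close>

lemma squeezing_pair_free:
  assumes d: "length xs = 4" "distinct xs" "\<forall>w\<in>set xs. length w = d" "3 \<le> d"
    and D1: "D1 \<in> squeezing K (xs ! 0) (xs ! 1) n" and D2: "D2 \<in> squeezing K' (xs ! 2) (xs ! 3) n'"
  shows "(D1, D2) \<in> free_pairs"
proof -
  let ?S = "{0..<1 :: real}" and ?I = "{..<2 :: nat}"
  define f where "f i = represented (if i = 0 then D1 else D2)" for i :: nat
  define L where "L p = (if snd p then f (fst p) else inv\<^bsub>BijGroup ?S\<^esub> f (fst p))" for p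
  \<comment> \<open>Even positions of \<open>xs\<close> hold source addresses and odd ones target
    addresses, so a generator is attracted to its target cell and its inverse to its source
    cell.\<close>
  define k where "k p = 2 * fst p + (if snd p then 1 else 0)" for p :: "nat \<times> bool"
  define U where "U p = cell (xs ! k p) 0 1" for p
  have diag: "D1 \<in> diagrams" "D2 \<in> diagrams"
    using D1 D2 squeezing_subset unfolding diagrams_def by blast+
  note T = represented_in_thompson_T[OF diag(1)] represented_in_thompson_T[OF diag(2)]
  have f: "f i \<in> Bij ?S" "f i \<in> carrier thompson_T" "inv\<^bsub>BijGroup ?S\<^esub> f i \<in> carrier thompson_T" for i
    using T by (auto simp: f_def)
  have TB: "carrier thompson_T \<subseteq> Bij ?S" by (auto simp: thompson_T_def)
  have L: "L p \<in> carrier thompson_T" for p using f by (simp add: L_def)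
  have squeeze: "f i x \<in> U (i, True)" if i: "i \<in> ?I" and x: "x \<in> ?S" "x \<notin> U (i, False)" for i x
  proof -
    have "i = 0 \<or> i = 1" using i by auto
    then show ?thesis
      using squeezing_maps[OF D1 x(1)] squeezing_maps[OF D2 x(1)] x(2)
      by (auto simp: f_def U_def k_def)
  qed
  have k: "k p < 4" if "p \<in> ?I \<times> UNIV" for p using that by (auto simp: k_def)
  have k_inj: "p = q" if "k p = k q" for p q
    using that by (cases p; cases q) (auto simp: k_def split: if_splits; presburger)+
  \<comment> \<open>There are at least 8 addresses of length \<open>d\<close>; one that is missing
    from \<open>xs\<close> supplies the base point.\<close>
  have "card (set xs) < card {w :: bool list. set w \<subseteq> UNIV \<and> length w = d}"
  proof -
    have "(2 :: nat) ^ 3 \<le> 2 ^ d" using d(4) by (intro power_increasing) auto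
    then show ?thesis
      using distinct_card[OF d(2)] d(1) by (subst card_lists_length_eq) auto
  qed
  then have "\<not> {w :: bool list. set w \<subseteq> UNIV \<and> length w = d} \<subseteq> set xs"
    using card_mono[OF finite_set, of _ xs] by (meson not_le)
  then obtain u where u: "length u = d" "u \<notin> set xs" by blast
  obtain x0 where x0: "x0 \<in> cell u 0 1" using cell_nonempty[of 0 1 u] by auto
  interpret ping_pong ?S ?I L U x0
  proof
    fix p q :: "nat \<times> bool"
    assume p: "p \<in> ?I \<times> UNIV"
    show "L p \<in> Bij ?S" using L TB by blast
    have "f (fst p) \<in> carrier (BijGroup ?S)" using f(1) by (simp add: BijGroup_def)
    then show "L (inv_letter p) = inv\<^bsub>BijGroup ?S\<^esub> L p"
      using group.inv_inv[OF group_BijGroup, of "f (fst p)"] by (simp add: L_def inv_letter_def)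
    show "x0 \<notin> U p"
    proof -
      have "xs ! k p \<in> set xs" using k[OF p] d(1) by simp
      then have "cell u 0 1 \<inter> U p = {}"
        unfolding U_def using u d(3) by (intro cell_disjoint) auto
      then show ?thesis using x0 by blast
    qed
    show "U p \<inter> U q = {}" if "q \<in> ?I \<times> UNIV" "p \<noteq> q"
    proof -
      have "xs ! k p \<noteq> xs ! k q"
        using k[OF p] k[OF that(1)] k_inj that(2) d(1,2) by (metis nth_eq_iff_index_eq)
      then show ?thesis
        unfolding U_def using k[OF p] k[OF that(1)] d(1,3) by (intro cell_disjoint) auto
    qed
    fix x
    assume x: "x \<in> ?S" "x \<notin> U (inv_letter p)"
    obtain i e where pe: "p = (i, e)" by (cases p)
    have i: "i \<in> ?I" using p pe by simp
    show "L p x \<in> U p"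
    proof (cases e)
      case True
      then show ?thesis using squeeze[OF i x(1)] x(2) pe by (simp add: L_def inv_letter_def)
    next
      case False
      have bij: "bij_betw (f i) ?S ?S" using f(1) by (simp add: Bij_def)
      define y where "y = inv_into ?S (f i) x"
      have y: "y \<in> ?S" "f i y = x"
        using bij x(1) unfolding y_def bij_betw_def by (metis inv_into_into, metis f_inv_into_f)
      \<comment> \<open>Contrapositive of \<open>squeeze\<close>: were the preimage \<open>y\<close>
        off the source cell, \<open>x\<close> would lie in the target cell.\<close>
      have "y \<in> U (i, False)"
        using squeeze[OF i y(1)] x(2) y(2) pe False by (auto simp: inv_letter_def)
      moreover have "L p x = y"
        using x(1) inv_BijGroup[OF f(1)[of i]] pe False by (simp add: L_def y_def)
      ultimately show ?thesis using pe False by simp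
    qed
  next
    show "x0 \<in> ?S" using x0 cell_subset[of 0 1 u] by auto
  qed
  have "thompson_T = BijGroup ?S\<lparr>carrier := carrier thompson_T\<rparr>"
    by (simp add: thompson_T_def)
  moreover have "(\<lambda>i. L (i, True)) ` ?I = {represented D1, represented D2}"
    by (auto simp: L_def f_def lessThan_Suc numeral_2_eq_2)
  ultimately have "subgroup_generated thompson_T {represented D1, represented D2} \<cong> free_group ?I"
    using free[OF TB L] by metis
  then show ?thesis using diag by (simp add: free_pairs_def)
qed

section \<open>Counting free pairs and the limit\<close>

lemma card_distinct_addresses:
  assumes "3 \<le> d"
  shows "(2 ^ d - 3) ^ 4 \<le> card {xs. length xs = 4 \<and> distinct xs \<and> set xs \<subseteq> {w :: bool list. length w = d}}"
proof -
  let ?W = "{w :: bool list. length w = d}"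
  have W: "card ?W = 2 ^ d" using card_lists_length_eq[of "UNIV :: bool set" d] by simp
  have "(2 :: nat) ^ 3 \<le> 2 ^ d" using assms by (intro power_increasing) auto
  then have q: "(8 :: nat) \<le> 2 ^ d" by simp
  \<comment> \<open>The count is a falling factorial with four factors, the smallest of which is
    \<open>2 ^ d - 3\<close>.\<close>
  have "(2 ^ d - 3) ^ 4 = (\<Prod>i\<in>{(2 :: nat) ^ d - 4 + 1..2 ^ d}. (2 :: nat) ^ d - 3)" using q by simp
  also have "\<dots> \<le> \<Prod>{2 ^ d - 4 + 1..2 ^ d}" by (intro prod_mono) auto
  also have "\<dots> = card {xs. length xs = 4 \<and> distinct xs \<and> set xs \<subseteq> ?W}"
    using card_lists_distinct_length_eq'[of 4 ?W] W q by simp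
  finally show ?thesis .
qed

text \<open>Every tuple of four distinct addresses contributes a block of free pairs. Four trees
  have to be giant, which costs \<open>c ^ 4\<close>, and two marks have to be good, which costs the
  squared fraction; the number of tuples supplies \<open>(2 ^ d - 3) ^ 4\<close>.\<close>

lemma card_free_pairs_ge:
  fixes c :: real
  assumes "3 \<le> d" "2 * K < n" "0 \<le> c"
    and c: "\<And>w. length w = d \<Longrightarrow> c * real (num_trees n) \<le> real (card (giant w K n))"
  shows "((2 ^ d - 3) * c) ^ 4 * (real ((n + 1) - K\<^sup>2) / (real n + 1))\<^sup>2 \<le>
    real (card (free_pairs \<inter> Sph2 n)) / real (card (Sph2 n))"
proof -
  let ?Q = "{xs. length xs = 4 \<and> distinct xs \<and> set xs \<subseteq> {w :: bool list. length w = d}}"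
  define E where "E xs = squeezing K (xs ! 0) (xs ! 1) n \<times> squeezing K (xs ! 2) (xs ! 3) n" for xs
  define N where "N = real (num_trees n)"
  define M where "M = real ((n + 1) - K\<^sup>2)"
  have "finite {w :: bool list. set w \<subseteq> UNIV \<and> length w = d}" by (rule finite_lists_length_eq) simp
  then have "finite {xs :: bool list list. set xs \<subseteq> {w. length w = d} \<and> length xs = 4}"
    by (intro finite_lists_length_eq) simp
  then have Q: "finite ?Q" by (rule rev_finite_subset) auto
  have finite_E: "finite (E xs)" for xs
    unfolding E_def using finite_subset[OF squeezing_subset finite_diagrams_of_size] by auto
  \<comment> \<open>A common pair of tuples that differ at position \<open>i\<close> would contain a
    tree that is giant at two addresses.\<close>
  have disj: "E xs \<inter> E ys = {}" if "xs \<in> ?Q" "ys \<in> ?Q" "xs \<noteq> ys" for xs ys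
  proof -
    have "\<exists>i<4. xs ! i \<noteq> ys ! i"
    proof (rule ccontr)
      assume "\<not> ?thesis"
      then have "xs = ys" using that(1,2) by (intro nth_equalityI) auto
      then show False using that(3) by simp
    qed
    then obtain i where i: "i < 4" "xs ! i \<noteq> ys ! i" by blast
    then have "xs ! i \<in> set xs" "ys ! i \<in> set ys" using that by auto
    then have "length (xs ! i) = length (ys ! i)" using that by auto
    then have "giant (xs ! i) K n \<inter> giant (ys ! i) K n = {}"
      using giant_disjoint i(2) assms(2) by blast
    moreover have "i = 0 \<or> i = 1 \<or> i = 2 \<or> i = 3" using i(1) by auto
    ultimately show ?thesis by (auto simp: E_def squeezing_def)
  qed
  have E_card: "(c * N * (c * N * M))\<^sup>2 \<le> real (card (E xs))" if "xs \<in> ?Q" for xs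
  proof -
    have sq: "c * N * (c * N * M) \<le> real (card (squeezing K w v n))"
      if "length w = d" "length v = d" for w v
    proof -
      have "c * N * (c * N * M) \<le> real (card (giant w K n)) * (real (card (giant v K n)) * M)"
        using c[OF that(1)] c[OF that(2)] assms(3) by (intro mult_mono) (auto simp: N_def M_def)
      also have "\<dots> = real (card (giant w K n) * (card (giant v K n) * ((n + 1) - K\<^sup>2)))"
        by (simp only: M_def of_nat_mult)
      also have "\<dots> \<le> real (card (squeezing K w v n))"
        using card_squeezing[of K n w v] assms(2) by (simp only: of_nat_le_iff)
      finally show ?thesis .
    qed
    have "length (xs ! i) = d" if "i < 4" for i
    proof -
      have "xs ! i \<in> set xs" using \<open>xs \<in> ?Q\<close> that by simp
      then show ?thesis using \<open>xs \<in> ?Q\<close> by blast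
    qed
    then have "(c * N * (c * N * M)) * (c * N * (c * N * M)) \<le>
        real (card (squeezing K (xs ! 0) (xs ! 1) n)) * real (card (squeezing K (xs ! 2) (xs ! 3) n))"
      using assms(3) by (intro mult_mono sq) (auto simp: N_def M_def)
    then show ?thesis by (simp add: E_def card_cartesian_product power2_eq_square)
  qed
  have N: "N > 0" using num_trees_pos by (simp add: N_def)
  have card_Sph: "real (card (Sph2 n)) = (N * (N * (real n + 1)))\<^sup>2"
    by (simp add: Sph2_def card_cartesian_product card_diagrams_of_size power2_eq_square N_def algebra_simps)
  have "(2 ^ d - 3 :: real) ^ 4 = real ((2 ^ d - 3) ^ 4)"
  proof -
    have "(2 :: nat) ^ 3 \<le> 2 ^ d" using assms(1) by (intro power_increasing) auto
    then show ?thesis by (simp add: of_nat_diff)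
  qed
  also have "\<dots> \<le> real (card ?Q)"
    using card_distinct_addresses[OF assms(1)] by (simp only: of_nat_le_iff)
  finally have "(2 ^ d - 3) ^ 4 * (c * N * (c * N * M))\<^sup>2 \<le> real (card ?Q) * (c * N * (c * N * M))\<^sup>2"
    by (intro mult_right_mono) auto
  also have "\<dots> \<le> (\<Sum>xs\<in>?Q. real (card (E xs)))"
    by (rule sum_bounded_below) (rule E_card)
  also have "\<dots> = real (card (\<Union>xs\<in>?Q. E xs))"
    using card_UN_disjoint[of ?Q E] Q finite_E disj by simp
  also have "\<dots> \<le> real (card (free_pairs \<inter> Sph2 n))"
  proof -
    have "(\<Union>xs\<in>?Q. E xs) \<subseteq> free_pairs \<inter> Sph2 n"
      using squeezing_pair_free[OF _ _ _ assms(1)] squeezing_subset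
      by (fastforce simp: E_def Sph2_def)
    then show ?thesis by (intro of_nat_mono card_mono) (auto simp: Sph2_def)
  qed
  finally have "(2 ^ d - 3) ^ 4 * (c * N * (c * N * M))\<^sup>2 / (N * (N * (real n + 1)))\<^sup>2
      \<le> real (card (free_pairs \<inter> Sph2 n)) / real (card (Sph2 n))"
    unfolding card_Sph by (rule divide_right_mono) simp
  moreover have "(2 ^ d - 3) ^ 4 * (c * N * (c * N * M))\<^sup>2 / (N * (N * (real n + 1)))\<^sup>2 =
      ((2 ^ d - 3) * c) ^ 4 * (M / (real n + 1))\<^sup>2"
  proof -
    define a y m where "a = N * N" and "y = c\<^sup>2 * M" and "m = real n + 1"
    have "a \<noteq> 0" using N by (simp add: a_def)
    then have "(a * y)\<^sup>2 / (a * m)\<^sup>2 = (y / m)\<^sup>2" by (simp flip: power_divide)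
    moreover have "c * N * (c * N * M) = a * y" "N * (N * (real n + 1)) = a * m"
      by (simp_all add: a_def y_def m_def power2_eq_square)
    moreover have "(2 ^ d - 3) ^ 4 * (y / m)\<^sup>2 = ((2 ^ d - 3) * c) ^ 4 * (M / m)\<^sup>2"
      by (simp add: y_def power_mult_distrib power_divide flip: power_mult)
    ultimately show ?thesis unfolding m_def[symmetric] by (metis times_divide_eq_right)
  qed
  ultimately show ?thesis by (simp add: M_def)
qed

theorem theorem3:
  shows "\<exists>L :: real. L > 0 \<and>
    (\<lambda>n. real (card (free_pairs \<inter> Sph2 n)) / real (card (Sph2 n))) \<longlonglongrightarrow> L"
proof (intro exI conjI)
  let ?r = "\<lambda>n. real (card (free_pairs \<inter> Sph2 n)) / real (card (Sph2 n))"
  show "?r \<longlonglongrightarrow> 1"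
  proof (rule order_tendstoI)
    fix e :: real
    assume "1 < e"
    have "?r n \<le> 1" for n
    proof -
      have "card (free_pairs \<inter> Sph2 n) \<le> card (Sph2 n)"
        by (intro card_mono) (auto simp: Sph2_def)
      then show ?thesis by (cases "card (Sph2 n) = 0") (simp_all add: divide_le_eq_1)
    qed
    then show "\<forall>\<^sub>F n in sequentially. ?r n < e"
      using \<open>1 < e\<close> by (intro always_eventually) (meson le_less_trans)
  next
    fix e :: real
    assume "e < 1"
    \<comment> \<open>Strictly below 2^(-d), as \<open>giant_density\<close> demands, but with ratio
      to it tending to 1, so that the product with \<open>2 ^ d - 3\<close> still tends to
      1.\<close>
    define c :: "nat \<Rightarrow> real" where "c d = (1 / 2) ^ d * (1 - (1 / 2) ^ d)" for d
    have half: "(\<lambda>d. (1 / 2 :: real) ^ d) \<longlonglongrightarrow> 0" by (intro LIMSEQ_power_zero) simp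
    have "(\<lambda>d. ((1 - 3 * (1 / 2) ^ d) * (1 - (1 / 2) ^ d)) ^ 4) \<longlonglongrightarrow> ((1 - 3 * 0) * (1 - 0 :: real)) ^ 4"
      by (intro tendsto_intros half)
    moreover have "(1 - 3 * (1 / 2) ^ d) * (1 - (1 / 2) ^ d) = (2 ^ d - 3) * c d" for d
      by (simp add: c_def power_one_over field_simps)
    ultimately have "(\<lambda>d. ((2 ^ d - 3) * c d) ^ 4) \<longlonglongrightarrow> 1" by simp
    then have "\<forall>\<^sub>F d in sequentially. e < ((2 ^ d - 3) * c d) ^ 4"
      using \<open>e < 1\<close> by (rule order_tendstoD)
    moreover have "\<forall>\<^sub>F d in sequentially. 3 \<le> (d :: nat)" by (rule eventually_ge_at_top)
    ultimately have "\<forall>\<^sub>F d in sequentially. 3 \<le> d \<and> e < ((2 ^ d - 3) * c d) ^ 4"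
      by eventually_elim simp
    then obtain d where d: "3 \<le> d" "e < ((2 ^ d - 3) * c d) ^ 4"
      by (auto simp: eventually_sequentially)
    have "(1 / 2 :: real) ^ d \<le> 1" by (intro power_le_one) auto
    then have "0 \<le> c d" by (simp add: c_def)
    have "c d < (1 / 2) ^ d * 1"
      unfolding c_def by (intro mult_strict_left_mono) auto
    then obtain K where K: "\<forall>\<^sub>F n in sequentially. \<forall>w. length w = d \<longrightarrow>
        c d * real (num_trees n) \<le> real (card (giant w K n))"
      using giant_density[of "c d" d] by auto
    \<comment> \<open>With \<open>d\<close> and \<open>K\<close> fixed, the bad marks are a bounded
      number out of \<open>n + 1\<close>.\<close>
    have "(\<lambda>n. (real ((n + 1) - K\<^sup>2) / (real n + 1))\<^sup>2) \<longlonglongrightarrow> 1\<^sup>2"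
    proof (intro tendsto_power)
      have "(\<lambda>n. (real n + 1 - real K ^ 2) / (real n + 1)) \<longlonglongrightarrow> 1" by real_asymp
      moreover have "\<forall>\<^sub>F n in sequentially.
          (real n + 1 - real K ^ 2) / (real n + 1) = real ((n + 1) - K\<^sup>2) / (real n + 1)"
        using eventually_ge_at_top[of "K\<^sup>2"] by eventually_elim (simp add: of_nat_diff)
      ultimately show "(\<lambda>n. real ((n + 1) - K\<^sup>2) / (real n + 1)) \<longlonglongrightarrow> 1"
        by (rule Lim_transform_eventually)
    qed
    then have "(\<lambda>n. ((2 ^ d - 3) * c d) ^ 4 * (real ((n + 1) - K\<^sup>2) / (real n + 1))\<^sup>2)
        \<longlonglongrightarrow> ((2 ^ d - 3) * c d) ^ 4 * 1\<^sup>2"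
      by (intro tendsto_mult tendsto_const)
    moreover have "e < ((2 ^ d - 3) * c d) ^ 4 * 1\<^sup>2" using d(2) by simp
    ultimately have "\<forall>\<^sub>F n in sequentially.
        e < ((2 ^ d - 3) * c d) ^ 4 * (real ((n + 1) - K\<^sup>2) / (real n + 1))\<^sup>2"
      by (rule order_tendstoD)
    then show "\<forall>\<^sub>F n in sequentially. e < ?r n"
      using K eventually_gt_at_top[of "2 * K"]
    proof eventually_elim
      case (elim n)
      then show ?case
        using card_free_pairs_ge[OF d(1) _ \<open>0 \<le> c d\<close>, of K n] by (meson less_le_trans)
    qed
  qed
qed simp

end
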